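(* (i) Let $(\mathfrak X,*,\mathbf 1)$ be an abstract super operator system. Then there exist a $\mathbb Z_2$-graded Hilbert space $\widehat{\mathcal H}$ and a completely isometric unital linear map $\varphi:\mathfrak X\to\mathcal B(\widehat{\mathcal H})$ with $\varphi(x^* )=\varphi(x)^*$ (superinvolution) for all $x\in\mathfrak X$. (ii) Let $(\mathfrak V,* )$ be an abstract super operator space. Then there exist a Hilbert space $\mathcal H$ and a completely isometric linear map $\nu:\mathfrak V\to\mathcal B(\mathcal H)$ with $\nu(v^* )=\nu(v)^{\dagger}$ (the ordinary adjoint) for all $v\in\mathfrak V$, i.e. $\mathfrak V$ is represented completely isometrically as a pre-operator system.
   Context: A $\mathbb Z_2$-graded Hilbert space is $\widehat{\mathcal H}=\mathcal H^{even}\oplus\mathcal H^{odd}$ with grading operator $\epsilon=\mathrm{diag}(1,-1)$; the superinvolution on $\mathcal B(\widehat{\mathcal H})$ is $x^*=\epsilon\,x^{\dagger}\,\epsilon$ where $x^\dagger$ is the ordinary adjoint. An antilinear involution $*$ on an operator space $\mathfrak V$ is completely antiisometric if for each $n$ the map $[x_{ij}]\mapsto[x_{ji}^*]$ is isometric on $M_n(\mathfrak V)$. An abstract super operator system $(\mathfrak X,*,\mathbf 1)$ is an abstract unital operator space (an abstract operator space with a specified element $\mathbf 1$ admitting a completely isometric representation on Hilbert space sending $\mathbf 1$ to the identity) equipped with a completely antiisometric antilinear involution fixing $\mathbf 1$. An abstract super operator space $(\mathfrak V,* )$ is an abstract operator space with a completely antiisometric antilinear involution. A pre-operator system is a selfadjoint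 subspace of some $\mathcal B(\mathcal H)$, not necessarily containing the identity. *)

theory Defs
  imports "HOL-Analysis.Analysis"
begin

text \<open>Every complex Hilbert space is unitarily equivalent to l2(I) for an index set I
  (an orthonormal basis).  An element of B(l2(I)) is represented by its matrix
  A i j (= inner product of e_i with A e_j), vanishing outside I x I.\<close>

definition sos_l2 :: "'i set \<Rightarrow> ('i \<Rightarrow> complex) set" where
  "sos_l2 I = {f. (\<forall>i. i \<notin> I \<longrightarrow> f i = 0) \<and> (\<lambda>i. (cmod (f i))\<^sup>2) summable_on I}"

definition sos_l2norm :: "'i set \<Rightarrow> ('i \<Rightarrow> complex) \<Rightarrow> real" where
  "sos_l2norm I f = sqrt (\<Sum>\<^sub>\<infinity>i\<in>I. (cmod (f i))\<^sup>2)"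

definition sos_apply :: "'i set \<Rightarrow> ('i \<Rightarrow> 'i \<Rightarrow> complex) \<Rightarrow> ('i \<Rightarrow> complex) \<Rightarrow> ('i \<Rightarrow> complex)" where
  "sos_apply I A f = (\<lambda>i. if i \<in> I then (\<Sum>\<^sub>\<infinity>j\<in>I. A i j * f j) else 0)"

definition sos_bounded :: "'i set \<Rightarrow> ('i \<Rightarrow> 'i \<Rightarrow> complex) \<Rightarrow> bool" where
  "sos_bounded I A \<longleftrightarrow>
     (\<forall>i j. (i \<notin> I \<or> j \<notin> I) \<longrightarrow> A i j = 0) \<and>
     (\<forall>f \<in> sos_l2 I. (\<forall>i\<in>I. (\<lambda>j. A i j * f j) summable_on I) \<and> sos_apply I A f \<in> sos_l2 I) \<and>
     (\<exists>C. \<forall>f \<in> sos_l2 I. sos_l2norm I (sos_apply I A f) \<le> C * sos_l2norm I f)"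

definition sos_opnorm :: "'i set \<Rightarrow> ('i \<Rightarrow> 'i \<Rightarrow> complex) \<Rightarrow> real" where
  "sos_opnorm I A = Sup {sos_l2norm I (sos_apply I A f) | f. f \<in> sos_l2 I \<and> sos_l2norm I f \<le> 1}"

text \<open>An n x n matrix [T_kl] of operators on l2(I) is an operator on l2(I)^n = l2({..<n} x I);
  its norm is the operator norm there (the canonical norm on M_n(B(H))).\<close>
definition sos_block :: "nat \<Rightarrow> (nat \<Rightarrow> nat \<Rightarrow> 'i \<Rightarrow> 'i \<Rightarrow> complex) \<Rightarrow> (nat \<times> 'i) \<Rightarrow> (nat \<times> 'i) \<Rightarrow> complex" where
  "sos_block n T = (\<lambda>(k, i) (l, j). if k < n \<and> l < n then T k l i j else 0)"

definition sos_matnorm :: "'i set \<Rightarrow> nat \<Rightarrow> (nat \<Rightarrow> nat \<Rightarrow> 'i \<Rightarrow> 'i \<Rightarrow> complex) \<Rightarrow> real" where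
  "sos_matnorm I n T = sos_opnorm ({..<n} \<times> I) (sos_block n T)"

definition sos_id :: "'i set \<Rightarrow> 'i \<Rightarrow> 'i \<Rightarrow> complex" where
  "sos_id I = (\<lambda>i j. if i \<in> I \<and> i = j then 1 else 0)"

definition sos_adj :: "('i \<Rightarrow> 'i \<Rightarrow> complex) \<Rightarrow> 'i \<Rightarrow> 'i \<Rightarrow> complex" where
  "sos_adj A = (\<lambda>i j. cnj (A j i))"

text \<open>Z2-graded l2(J) with even part l2(E), odd part l2(J - E); grading operator
  eps = diag(1,-1); superinvolution x^* = eps x^dagger eps.\<close>
definition sos_grade :: "'i set \<Rightarrow> 'i \<Rightarrow> complex" where
  "sos_grade E i = (if i \<in> E then 1 else -1)"

definition sos_superadj :: "'i set \<Rightarrow> ('i \<Rightarrow> 'i \<Rightarrow> complex) \<Rightarrow> 'i \<Rightarrow> 'i \<Rightarrow> complex" where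
  "sos_superadj E A = (\<lambda>i j. sos_grade E i * cnj (A j i) * sos_grade E j)"

text \<open>Matrices over V: n x n matrices are functions nat => nat => 'v, only entries with
  indices < n matter.  Scalar matrix norm ||alpha|| of alpha in M_{n,m}(C) is the operator
  norm C^m -> C^n.\<close>

definition sos_cmatnorm :: "nat \<Rightarrow> nat \<Rightarrow> (nat \<Rightarrow> nat \<Rightarrow> complex) \<Rightarrow> real" where
  "sos_cmatnorm n m \<alpha> = Sup {sqrt (\<Sum>i<n. (cmod (\<Sum>j<m. \<alpha> i j * \<xi> j))\<^sup>2) | \<xi>.
                              (\<Sum>j<m. (cmod (\<xi> j))\<^sup>2) \<le> 1}"

definition sos_mmul :: "(complex \<Rightarrow> 'v \<Rightarrow> 'v::ab_group_add) \<Rightarrow> nat \<Rightarrow> (nat \<Rightarrow> nat \<Rightarrow> complex)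
     \<Rightarrow> (nat \<Rightarrow> nat \<Rightarrow> 'v) \<Rightarrow> (nat \<Rightarrow> nat \<Rightarrow> complex) \<Rightarrow> nat \<Rightarrow> nat \<Rightarrow> 'v" where
  "sos_mmul sc m \<alpha> x \<beta> = (\<lambda>i k. \<Sum>j<m. \<Sum>l<m. sc (\<alpha> i j * \<beta> l k) (x j l))"

definition sos_dsum :: "nat \<Rightarrow> (nat \<Rightarrow> nat \<Rightarrow> 'v::zero) \<Rightarrow> (nat \<Rightarrow> nat \<Rightarrow> 'v) \<Rightarrow> nat \<Rightarrow> nat \<Rightarrow> 'v" where
  "sos_dsum n x y = (\<lambda>i j. if i < n \<and> j < n then x i j
                           else if n \<le> i \<and> n \<le> j then y (i - n) (j - n) else 0)"

definition abstract_operator_space ::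
  "(complex \<Rightarrow> 'v \<Rightarrow> 'v::ab_group_add) \<Rightarrow> (nat \<Rightarrow> (nat \<Rightarrow> nat \<Rightarrow> 'v) \<Rightarrow> real) \<Rightarrow> bool" where
  "abstract_operator_space sc N \<longleftrightarrow>
     vector_space sc \<and>
     (\<forall>n x y. (\<forall>i<n. \<forall>j<n. x i j = y i j) \<longrightarrow> N n x = N n y) \<and>
     (\<forall>n x. 0 \<le> N n x) \<and>
     (\<forall>n x. N n x = 0 \<longleftrightarrow> (\<forall>i<n. \<forall>j<n. x i j = 0)) \<and>
     (\<forall>n x y. N n (\<lambda>i j. x i j + y i j) \<le> N n x + N n y) \<and>
     (\<forall>n c x. N n (\<lambda>i j. sc c (x i j)) = cmod c * N n x) \<and>
     (\<forall>n m \<alpha> x \<beta>. N n (sos_mmul sc m \<alpha> x \<beta>) \<le> sos_cmatnorm n m \<alpha> * N m x * sos_cmatnorm m n \<beta>) \<and>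
     (\<forall>n m x y. N (n + m) (sos_dsum n x y) = max (N n x) (N m y))"

definition ca_involution ::
  "(complex \<Rightarrow> 'v \<Rightarrow> 'v::ab_group_add) \<Rightarrow> (nat \<Rightarrow> (nat \<Rightarrow> nat \<Rightarrow> 'v) \<Rightarrow> real) \<Rightarrow> ('v \<Rightarrow> 'v) \<Rightarrow> bool" where
  "ca_involution sc N st \<longleftrightarrow>
     (\<forall>x y. st (x + y) = st x + st y) \<and>
     (\<forall>c x. st (sc c x) = sc (cnj c) (st x)) \<and>
     (\<forall>x. st (st x) = x) \<and>
     (\<forall>n x. N n (\<lambda>i j. st (x j i)) = N n x)"

definition ci_map ::
  "(complex \<Rightarrow> 'v \<Rightarrow> 'v::ab_group_add) \<Rightarrow> (nat \<Rightarrow> (nat \<Rightarrow> nat \<Rightarrow> 'v) \<Rightarrow> real) \<Rightarrow> 'i set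
     \<Rightarrow> ('v \<Rightarrow> 'i \<Rightarrow> 'i \<Rightarrow> complex) \<Rightarrow> bool" where
  "ci_map sc N I \<phi> \<longleftrightarrow>
     (\<forall>x. sos_bounded I (\<phi> x)) \<and>
     (\<forall>x y. \<phi> (x + y) = (\<lambda>i j. \<phi> x i j + \<phi> y i j)) \<and>
     (\<forall>c x. \<phi> (sc c x) = (\<lambda>i j. c * \<phi> x i j)) \<and>
     (\<forall>n X. sos_matnorm I n (\<lambda>k l. \<phi> (X k l)) = N n X)"

text \<open>Abstract unital operator space: an abstract operator space with an element 1 admitting a
  completely isometric representation on a Hilbert space sending 1 to the identity.  The
  Hilbert space is l2(I) for some index set I of the type given by the itself-argument;
  a free type variable in a hypothesis makes this "for some Hilbert space".\<close>
definition abstract_unital_operator_space ::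
  "'i itself \<Rightarrow> (complex \<Rightarrow> 'v \<Rightarrow> 'v::ab_group_add) \<Rightarrow> (nat \<Rightarrow> (nat \<Rightarrow> nat \<Rightarrow> 'v) \<Rightarrow> real) \<Rightarrow> 'v \<Rightarrow> bool" where
  "abstract_unital_operator_space (_::'i itself) sc N one \<longleftrightarrow>
     abstract_operator_space sc N \<and>
     (\<exists>(I::'i set) \<psi>. ci_map sc N I \<psi> \<and> \<psi> one = sos_id I)"

definition abstract_super_operator_system ::
  "'i itself \<Rightarrow> (complex \<Rightarrow> 'v \<Rightarrow> 'v::ab_group_add) \<Rightarrow> (nat \<Rightarrow> (nat \<Rightarrow> nat \<Rightarrow> 'v) \<Rightarrow> real)
     \<Rightarrow> ('v \<Rightarrow> 'v) \<Rightarrow> 'v \<Rightarrow> bool" where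
  "abstract_super_operator_system T sc N st one \<longleftrightarrow>
     abstract_unital_operator_space T sc N one \<and> ca_involution sc N st \<and> st one = one"

definition abstract_super_operator_space ::
  "(complex \<Rightarrow> 'v \<Rightarrow> 'v::ab_group_add) \<Rightarrow> (nat \<Rightarrow> (nat \<Rightarrow> nat \<Rightarrow> 'v) \<Rightarrow> real) \<Rightarrow> ('v \<Rightarrow> 'v) \<Rightarrow> bool" where
  "abstract_super_operator_space sc N st \<longleftrightarrow>
     abstract_operator_space sc N \<and> ca_involution sc N st"

end

(*
  (i) With a = psi(x) and b = psi(st x)^dagger, the map x |-> diag(a, b) is completely isometric
  because st is completely antiisometric, and it turns st into the adjoint followed by the flip of
  the two summands.  A Hadamard rotation diagonalises the flip to diag(1, -1).

  (ii) v |-> [[0, psi(v)], [psi(st v)^dagger, 0]] does the same for the ordinary adjoint once psi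
  is a complete isometry, whose existence is Ruan's theorem.  For each x in M_n(V) a single
  Hahn-Banach separation suffices: in M_n(C) x M_n(V) x M_n(C) take the convex cone of triples
  (a, alpha u beta, b) with N u <= 1, a >= alpha alpha^*, b >= beta^* beta.  Its order unit is
  (1, 0, 1), and (t, -x, t) lies in the cone only if N x <= t, so there is a positive functional L
  with L(1, 0, 1) = 1 and L(0, x, 0) >= N x.  The two scalar components of L give semi-inner
  products on C^n, the middle one a bilinear form contractive with respect to them; Gram-Schmidt
  turns this form into a complete contraction V -> M_n that attains the norm of x.  The direct
  sum of these maps over all n and x is psi.
*)
theory Submission
  imports Defs "HOL-Library.Function_Algebras"
begin

section \<open>Operator norms through finite sums\<close>

text \<open>Positivity of a functional on the cone yields an additive estimate by a sum of squared
  norms. Dilations and direct sums preserve such estimates because squared norms add, and the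
  operator norm on l2 is the least constant in one, so infinite sums occur only in that last
  translation. The usual road to Ruan's theorem first takes a functional on M_n(V) and then needs a
  second convexity argument to find two states dominating it. Here the cone carries the two scalar
  matrices along, so the dominating forms come out of the separation itself. They arrive with joint
  mass 1 rather than mass 1 each, which the additive estimate absorbs. The direct-sum axiom makes
  the cone closed under addition; the bimodule axiom keeps (t, -x, t) out of it for t < N x. The
  size of the middle matrix in the cone is free, and this makes the resulting maps completely
  contractive, not merely contractive. The forms obtained on C^n may be degenerate. Their null
  vectors are harmless because the additive bound, under rescaling, forces the bilinear form to
  vanish on them.\<close>

text \<open>The additive right-hand side is equivalent to a bound by C times the product of the two
  norms (rescale the vectors), but adds up without Cauchy-Schwarz over orthogonal decompositions.\<close>
definition form_bounded :: "'i set \<Rightarrow> ('i \<Rightarrow> 'i \<Rightarrow> complex) \<Rightarrow> real \<Rightarrow> bool" where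
  "form_bounded I A C \<longleftrightarrow> (\<forall>F \<eta> \<xi>. finite F \<longrightarrow> F \<subseteq> I \<longrightarrow>
     2 * cmod (\<Sum>i\<in>F. \<Sum>j\<in>F. \<eta> i * A i j * \<xi> j) \<le> C * ((\<Sum>i\<in>F. (cmod (\<eta> i))\<^sup>2) + (\<Sum>j\<in>F. (cmod (\<xi> j))\<^sup>2)))"

lemma form_boundedI:
  assumes "\<And>F \<eta> \<xi>. finite F \<Longrightarrow> F \<subseteq> I \<Longrightarrow>
     2 * cmod (\<Sum>i\<in>F. \<Sum>j\<in>F. \<eta> i * A i j * \<xi> j) \<le> C * ((\<Sum>i\<in>F. (cmod (\<eta> i))\<^sup>2) + (\<Sum>j\<in>F. (cmod (\<xi> j))\<^sup>2))"
  shows "form_bounded I A C"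
  using assms unfolding form_bounded_def by blast

text \<open>Both vectors are extended by zero to \<open>F \<union> G\<close>. Separate row and
  column sets are needed for limits over columns with the rows held fixed.\<close>

lemma form_bounded_rect:
  assumes A: "form_bounded I A C" and F: "finite F" "F \<subseteq> I" and G: "finite G" "G \<subseteq> I"
  shows "2 * cmod (\<Sum>i\<in>F. \<Sum>j\<in>G. \<eta> i * A i j * \<xi> j)
         \<le> C * ((\<Sum>i\<in>F. (cmod (\<eta> i))\<^sup>2) + (\<Sum>j\<in>G. (cmod (\<xi> j))\<^sup>2))"
proof -
  let ?\<eta> = "\<lambda>i. if i \<in> F then \<eta> i else 0" and ?\<xi> = "\<lambda>j. if j \<in> G then \<xi> j else 0"
  have 1: "(\<Sum>j\<in>F \<union> G. ?\<eta> i * A i j * ?\<xi> j) = (\<Sum>j\<in>G. ?\<eta> i * A i j * \<xi> j)" for i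
    by (rule sum.mono_neutral_cong_right) (use F G in auto)
  have "(\<Sum>i\<in>F \<union> G. \<Sum>j\<in>F \<union> G. ?\<eta> i * A i j * ?\<xi> j) = (\<Sum>i\<in>F. \<Sum>j\<in>G. \<eta> i * A i j * \<xi> j)"
    unfolding 1 by (rule sum.mono_neutral_cong_right) (use F G in auto)
  moreover have "(\<Sum>i\<in>F \<union> G. (cmod (?\<eta> i))\<^sup>2) = (\<Sum>i\<in>F. (cmod (\<eta> i))\<^sup>2)"
    by (rule sum.mono_neutral_cong_right) (use F G in auto)
  moreover have "(\<Sum>i\<in>F \<union> G. (cmod (?\<xi> i))\<^sup>2) = (\<Sum>i\<in>G. (cmod (\<xi> i))\<^sup>2)"
    by (rule sum.mono_neutral_cong_right) (use F G in auto)
  moreover have "finite (F \<union> G)" "F \<union> G \<subseteq> I" using F G by auto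
  ultimately show ?thesis
    using A[unfolded form_bounded_def, rule_format, of "F \<union> G" ?\<eta> ?\<xi>] by simp
qed

text \<open>Let \<open>Y\<close> be the squared norm of the image and \<open>Z\<close> that of
  \<open>\<xi>\<close>. Testing against \<open>s\<close> times the conjugated image gives
  \<open>2 s Y \<le> C (s^2 Y + Z)\<close> for every \<open>s \<ge> 0\<close>, and
  \<open>s = 1 / C\<close> turns this into the norm estimate.\<close>

lemma form_bounded_image_sum:
  assumes A: "form_bounded I A C" and F: "finite F" "F \<subseteq> I" and G: "finite G" "G \<subseteq> I"
  shows "(\<Sum>i\<in>F. (cmod (\<Sum>j\<in>G. A i j * \<xi> j))\<^sup>2) \<le> C\<^sup>2 * (\<Sum>j\<in>G. (cmod (\<xi> j))\<^sup>2)"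
proof -
  define y where "y i = (\<Sum>j\<in>G. A i j * \<xi> j)" for i
  define Y where "Y = (\<Sum>i\<in>F. (cmod (y i))\<^sup>2)"
  define Z where "Z = (\<Sum>j\<in>G. (cmod (\<xi> j))\<^sup>2)"
  have "Y \<ge> 0" "Z \<ge> 0" unfolding Y_def Z_def by (auto intro: sum_nonneg)
  have key: "2 * s * Y \<le> C * (s\<^sup>2 * Y + Z)" if "s \<ge> 0" for s :: real
  proof -
    let ?\<eta> = "\<lambda>i. of_real s * cnj (y i)"
    have "(\<Sum>i\<in>F. \<Sum>j\<in>G. ?\<eta> i * A i j * \<xi> j) = (\<Sum>i\<in>F. ?\<eta> i * y i)"
      by (simp add: y_def sum_distrib_left mult.assoc)
    also have "\<dots> = of_real (s * Y)"
      unfolding Y_def of_real_mult of_real_sum sum_distrib_left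
      by (rule sum.cong) (auto simp: complex_norm_square mult_ac simp flip: of_real_power)
    finally have "cmod (\<Sum>i\<in>F. \<Sum>j\<in>G. ?\<eta> i * A i j * \<xi> j) = s * Y"
      using \<open>Y \<ge> 0\<close> that by (simp only: norm_of_real) simp
    moreover have "(\<Sum>i\<in>F. (cmod (?\<eta> i))\<^sup>2) = s\<^sup>2 * Y"
      using that by (simp add: Y_def norm_mult power_mult_distrib sum_distrib_left)
    ultimately show ?thesis
      using form_bounded_rect[OF A F G, of ?\<eta> \<xi>] unfolding Z_def by (simp add: mult.assoc)
  qed
  have "Y \<le> C\<^sup>2 * Z"
  proof (cases "C > 0")
    case True
    have "2 * (1/C) * Y \<le> C * ((1/C)\<^sup>2 * Y + Z)" using True by (intro key) auto
    then show ?thesis using True by (simp add: field_simps power2_eq_square)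
  next
    case False
    have "2 * Y \<le> C * (Y + Z)" using key[of 1] by simp
    also have "\<dots> \<le> 0" using False \<open>Y \<ge> 0\<close> \<open>Z \<ge> 0\<close> by (simp add: mult_nonpos_nonneg)
    finally have "Y \<le> 0" by simp
    then show ?thesis using \<open>Z \<ge> 0\<close> by (meson order_trans zero_le_mult_iff zero_le_power2)
  qed
  then show ?thesis unfolding Y_def Z_def y_def .
qed

text \<open>The conjugated row is its own test vector: its truncated squared norm \<open>R\<close>
  satisfies \<open>R^2 \<le> C^2 R\<close>. Rows are thus square summable, which makes the series
  defining the action on l2 converge.\<close>

lemma form_bounded_row:
  assumes A: "form_bounded I A C" and "i \<in> I" and G: "finite G" "G \<subseteq> I"
  shows "(\<Sum>j\<in>G. (cmod (A i j))\<^sup>2) \<le> C\<^sup>2"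
proof -
  define R where "R = (\<Sum>j\<in>G. (cmod (A i j))\<^sup>2)"
  have "R \<ge> 0" unfolding R_def by (auto intro: sum_nonneg)
  have "(cmod (\<Sum>j\<in>G. A i j * cnj (A i j)))\<^sup>2 \<le> C\<^sup>2 * (\<Sum>j\<in>G. (cmod (cnj (A i j)))\<^sup>2)"
    using form_bounded_image_sum[OF A _ _ G, of "{i}" "\<lambda>j. cnj (A i j)"] \<open>i \<in> I\<close> by simp
  moreover have "(\<Sum>j\<in>G. A i j * cnj (A i j)) = of_real R"
    unfolding R_def of_real_sum
    by (rule sum.cong) (auto simp: complex_norm_square mult_ac simp flip: of_real_power)
  ultimately have "(cmod (of_real R))\<^sup>2 \<le> C\<^sup>2 * R" by (simp only: R_def complex_mod_cnj)
  then have "R * R \<le> C\<^sup>2 * R" by (simp add: power2_eq_square)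
  then show ?thesis using \<open>R \<ge> 0\<close> unfolding R_def[symmetric]
    by (metis mult_le_cancel_right order_le_less zero_le_power2)
qed

lemma form_bounded_row_summable:
  assumes A: "form_bounded I A C" and "i \<in> I" and f: "f \<in> sos_l2 I"
  shows "(\<lambda>j. A i j * f j) summable_on I"
proof -
  have 1: "(\<lambda>j. (cmod (A i j))\<^sup>2) summable_on I"
    by (rule nonneg_bdd_above_summable_on)
       (auto intro!: bdd_aboveI[where M = "C\<^sup>2"] form_bounded_row[OF A \<open>i \<in> I\<close>])
  have 2: "(\<lambda>j. (cmod (f j))\<^sup>2) summable_on I" using f by (simp add: sos_l2_def)
  have "(\<lambda>j. norm (A i j * f j)) summable_on I"
  proof (rule Infinite_Sum.abs_summable_on_comparison_test')
    show "(\<lambda>j. (cmod (A i j))\<^sup>2 + (cmod (f j))\<^sup>2) summable_on I"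
      by (rule summable_on_add[OF 1 2])
    fix j
    have "0 \<le> (cmod (A i j) - cmod (f j))\<^sup>2" "0 \<le> cmod (A i j) * cmod (f j)" by auto
    then show "cmod (A i j * f j) \<le> (cmod (A i j))\<^sup>2 + (cmod (f j))\<^sup>2"
      unfolding power2_diff norm_mult by linarith
  qed
  then show ?thesis by (rule abs_summable_summable)
qed

text \<open>Rows stay in a finite \<open>F\<close> while the finite column sets \<open>G\<close>
  exhaust \<open>I\<close>. The finite estimate survives this limit because only finitely many rows
  are involved; \<open>F\<close> is enlarged last.\<close>

lemma form_bounded_apply:
  assumes A: "form_bounded I A C" and "0 \<le> C" and f: "f \<in> sos_l2 I"
  shows "sos_apply I A f \<in> sos_l2 I" and "sos_l2norm I (sos_apply I A f) \<le> C * sos_l2norm I f"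
proof -
  have sf: "(\<lambda>j. (cmod (f j))\<^sup>2) summable_on I" using f by (simp add: sos_l2_def)
  define Z where "Z = (\<Sum>\<^sub>\<infinity>j\<in>I. (cmod (f j))\<^sup>2)"
  have fin: "(\<Sum>i\<in>F. (cmod (sos_apply I A f i))\<^sup>2) \<le> C\<^sup>2 * Z" if F: "finite F" "F \<subseteq> I" for F
  proof (rule tendsto_upperbound)
    show "((\<lambda>G. \<Sum>i\<in>F. (cmod (\<Sum>j\<in>G. A i j * f j))\<^sup>2) \<longlongrightarrow> (\<Sum>i\<in>F. (cmod (sos_apply I A f i))\<^sup>2)) (finite_subsets_at_top I)"
    proof (intro tendsto_sum tendsto_power tendsto_norm)
      fix i assume "i \<in> F"
      then have "i \<in> I" using F by auto
      then show "((\<lambda>G. \<Sum>j\<in>G. A i j * f j) \<longlongrightarrow> sos_apply I A f i) (finite_subsets_at_top I)"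
        unfolding sos_apply_def using infsum_tendsto[OF form_bounded_row_summable[OF A \<open>i \<in> I\<close> f]] by simp
    qed
    show "\<forall>\<^sub>F G in finite_subsets_at_top I. (\<Sum>i\<in>F. (cmod (\<Sum>j\<in>G. A i j * f j))\<^sup>2) \<le> C\<^sup>2 * Z"
    proof (rule eventually_finite_subsets_at_top_weakI)
      fix G assume G: "finite G" "G \<subseteq> I"
      have "(\<Sum>i\<in>F. (cmod (\<Sum>j\<in>G. A i j * f j))\<^sup>2) \<le> C\<^sup>2 * (\<Sum>j\<in>G. (cmod (f j))\<^sup>2)"
        by (rule form_bounded_image_sum[OF A F G])
      also have "\<dots> \<le> C\<^sup>2 * Z"
        unfolding Z_def by (intro mult_left_mono finite_sum_le_infsum sf G) auto
      finally show "(\<Sum>i\<in>F. (cmod (\<Sum>j\<in>G. A i j * f j))\<^sup>2) \<le> C\<^sup>2 * Z" .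
    qed
  qed simp
  have s: "(\<lambda>i. (cmod (sos_apply I A f i))\<^sup>2) summable_on I"
    by (rule nonneg_bdd_above_summable_on) (auto intro!: bdd_aboveI[where M = "C\<^sup>2 * Z"] fin)
  then show "sos_apply I A f \<in> sos_l2 I" by (simp add: sos_l2_def sos_apply_def)
  have "(\<Sum>\<^sub>\<infinity>i\<in>I. (cmod (sos_apply I A f i))\<^sup>2) \<le> C\<^sup>2 * Z"
    by (rule infsum_le_finite_sums[OF s fin])
  then have "sos_l2norm I (sos_apply I A f) \<le> sqrt (C\<^sup>2 * Z)"
    unfolding sos_l2norm_def by simp
  then show "sos_l2norm I (sos_apply I A f) \<le> C * sos_l2norm I f"
    using \<open>0 \<le> C\<close> by (simp add: real_sqrt_mult sos_l2norm_def Z_def)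
qed

lemma sos_l2norm_nonneg: "0 \<le> sos_l2norm I f"
  unfolding sos_l2norm_def by (simp add: infsum_nonneg)

lemma form_bounded_imp_sos_bounded:
  assumes "form_bounded I A C" "0 \<le> C" "\<And>i j. i \<notin> I \<or> j \<notin> I \<Longrightarrow> A i j = 0"
  shows "sos_bounded I A" and "sos_opnorm I A \<le> C"
proof -
  show "sos_bounded I A"
    unfolding sos_bounded_def
    using assms form_bounded_row_summable[OF assms(1)] form_bounded_apply[OF assms(1,2)] by blast
  have z: "(\<lambda>i. 0) \<in> sos_l2 I" "sos_l2norm I (\<lambda>i. 0) \<le> 1"
    by (auto simp: sos_l2_def sos_l2norm_def)
  show "sos_opnorm I A \<le> C"
    unfolding sos_opnorm_def
  proof (rule cSup_least)
    show "{sos_l2norm I (sos_apply I A f) | f. f \<in> sos_l2 I \<and> sos_l2norm I f \<le> 1} \<noteq> {}"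
      using z by blast
    fix v assume "v \<in> {sos_l2norm I (sos_apply I A f) | f. f \<in> sos_l2 I \<and> sos_l2norm I f \<le> 1}"
    then obtain f where f: "f \<in> sos_l2 I" "sos_l2norm I f \<le> 1" "v = sos_l2norm I (sos_apply I A f)" by blast
    have "v \<le> C * sos_l2norm I f" using form_bounded_apply[OF assms(1,2)] f by blast
    also have "\<dots> \<le> C * 1" using f \<open>0 \<le> C\<close> by (intro mult_left_mono) auto
    finally show "v \<le> C" by simp
  qed
qed

lemma sos_opnorm_bound:
  assumes "sos_bounded I A" "f \<in> sos_l2 I" "sos_l2norm I f \<le> 1"
  shows "sos_l2norm I (sos_apply I A f) \<le> sos_opnorm I A"
  unfolding sos_opnorm_def
proof (rule cSup_upper)
  show "sos_l2norm I (sos_apply I A f) \<in> {sos_l2norm I (sos_apply I A f) | f. f \<in> sos_l2 I \<and> sos_l2norm I f \<le> 1}"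
    using assms by blast
  from assms(1) obtain C where C: "\<And>f. f \<in> sos_l2 I \<Longrightarrow> sos_l2norm I (sos_apply I A f) \<le> C * sos_l2norm I f"
    unfolding sos_bounded_def by blast
  show "bdd_above {sos_l2norm I (sos_apply I A f) | f. f \<in> sos_l2 I \<and> sos_l2norm I f \<le> 1}"
  \<comment> \<open>The constant supplied by \<open>sos_bounded\<close> carries no sign, hence the
    absolute value.\<close>
  proof (rule bdd_aboveI[where M = "\<bar>C\<bar>"])
    fix v assume "v \<in> {sos_l2norm I (sos_apply I A f) | f. f \<in> sos_l2 I \<and> sos_l2norm I f \<le> 1}"
    then obtain f where f: "f \<in> sos_l2 I" "sos_l2norm I f \<le> 1" "v = sos_l2norm I (sos_apply I A f)" by blast
    have "v \<le> C * sos_l2norm I f" using C f by simp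
    also have "\<dots> \<le> \<bar>C\<bar> * sos_l2norm I f" by (intro mult_right_mono sos_l2norm_nonneg) auto
    also have "\<dots> \<le> \<bar>C\<bar> * 1" using f by (intro mult_left_mono) auto
    finally show "v \<le> \<bar>C\<bar>" by simp
  qed
qed

lemma sos_opnorm_nonneg:
  assumes "sos_bounded I A"
  shows "0 \<le> sos_opnorm I A"
proof -
  have "(\<lambda>i. 0) \<in> sos_l2 I" "sos_l2norm I (\<lambda>i. 0) \<le> 1"
    by (auto simp: sos_l2_def sos_l2norm_def)
  from sos_opnorm_bound[OF assms this] sos_l2norm_nonneg show ?thesis by (meson order_trans)
qed

text \<open>A finitely supported vector is normalised to a unit vector of l2 so that the supremum
  applies; Cauchy-Schwarz and \<open>2 e r \<le> e^2 + r^2\<close> then lead to the additive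
  form.\<close>

lemma sos_bounded_imp_form_bounded:
  assumes A: "sos_bounded I A"
  shows "form_bounded I A (sos_opnorm I A)"
proof (rule form_boundedI)
  fix F and \<eta> \<xi> :: "'a \<Rightarrow> complex" assume F: "finite F" "F \<subseteq> I"
  define C where "C = sos_opnorm I A"
  have "0 \<le> C" unfolding C_def by (rule sos_opnorm_nonneg[OF A])
  define r where "r = L2_set (\<lambda>i. cmod (\<xi> i)) F"
  define e where "e = L2_set (\<lambda>i. cmod (\<eta> i)) F"
  define y where "y i = (\<Sum>j\<in>F. A i j * \<xi> j)" for i
  have nn: "0 \<le> r" "0 \<le> e" unfolding r_def e_def by auto
  have y: "L2_set (\<lambda>i. cmod (y i)) F \<le> C * r"
  \<comment> \<open>A vector of norm 0 cannot be normalised, but it vanishes on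
    \<open>F\<close>.\<close>
  proof (cases "r = 0")
    case True
    then have "\<xi> j = 0" if "j \<in> F" for j
      using that F unfolding r_def by (simp add: L2_set_eq_0_iff)
    then have "y i = 0" for i unfolding y_def by (auto intro: sum.neutral)
    then show ?thesis using \<open>0 \<le> C\<close> nn by (simp add: L2_set_0')
  next
    case False
    then have "r > 0" using nn by simp
    define f where "f i = (if i \<in> F then \<xi> i / of_real r else 0)" for i
    have s: "(\<Sum>\<^sub>\<infinity>i\<in>I. (cmod (f i))\<^sup>2) = (\<Sum>i\<in>F. (cmod (f i))\<^sup>2)"
    proof -
      have "(\<Sum>\<^sub>\<infinity>i\<in>I. (cmod (f i))\<^sup>2) = (\<Sum>\<^sub>\<infinity>i\<in>F. (cmod (f i))\<^sup>2)"
        by (rule infsum_cong_neutral) (use F in \<open>auto simp: f_def\<close>)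
      then show ?thesis using F by simp
    qed
    have "(\<Sum>i\<in>F. (cmod (f i))\<^sup>2) = (\<Sum>i\<in>F. (cmod (\<xi> i))\<^sup>2 / r\<^sup>2)"
      by (rule sum.cong) (auto simp: f_def norm_divide power_divide)
    also have "\<dots> = r\<^sup>2 / r\<^sup>2"
      by (simp add: r_def L2_set_def sum_nonneg flip: sum_divide_distrib)
    finally have s1: "(\<Sum>i\<in>F. (cmod (f i))\<^sup>2) = 1" using \<open>r > 0\<close> by simp
    have fl: "f \<in> sos_l2 I"
    proof -
      have "(\<lambda>i. (cmod (f i))\<^sup>2) summable_on I"
        by (rule finite_nonzero_values_imp_summable_on, rule finite_subset[OF _ F(1)]) (auto simp: f_def)
      then show ?thesis using F by (auto simp: sos_l2_def f_def)
    qed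
    have fn: "sos_l2norm I f \<le> 1" unfolding sos_l2norm_def s s1 by simp
    have ap: "sos_apply I A f i = y i / of_real r" if "i \<in> I" for i
    proof -
      have "(\<Sum>\<^sub>\<infinity>j\<in>I. A i j * f j) = (\<Sum>\<^sub>\<infinity>j\<in>F. A i j * \<xi> j / of_real r)"
        by (rule infsum_cong_neutral) (use F in \<open>auto simp: f_def\<close>)
      then show ?thesis using that F by (simp add: sos_apply_def y_def sum_divide_distrib)
    qed
    have al: "sos_apply I A f \<in> sos_l2 I" using A fl unfolding sos_bounded_def by blast
    have "L2_set (\<lambda>i. cmod (y i)) F / r = L2_set (\<lambda>i. cmod (sos_apply I A f i)) F"
    proof -
      have "L2_set (\<lambda>i. cmod (sos_apply I A f i)) F = L2_set (\<lambda>i. (1/r) * cmod (y i)) F"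
        by (rule L2_set_cong) (use F \<open>r > 0\<close> in \<open>auto simp: ap norm_divide subset_iff\<close>)
      also have "\<dots> = (1/r) * L2_set (\<lambda>i. cmod (y i)) F"
        using \<open>r > 0\<close> by (subst L2_set_right_distrib) auto
      finally show ?thesis by simp
    qed
    also have "\<dots> \<le> sos_l2norm I (sos_apply I A f)"
      unfolding L2_set_def sos_l2norm_def
      using al by (intro real_sqrt_le_mono finite_sum_le_infsum F) (auto simp: sos_l2_def)
    also have "\<dots> \<le> C" unfolding C_def by (rule sos_opnorm_bound[OF A fl fn])
    finally show ?thesis using \<open>r > 0\<close> by (simp add: field_simps)
  qed
  have "cmod (\<Sum>i\<in>F. \<Sum>j\<in>F. \<eta> i * A i j * \<xi> j) = cmod (\<Sum>i\<in>F. \<eta> i * y i)"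
    by (simp add: y_def sum_distrib_left mult.assoc)
  also have "\<dots> \<le> (\<Sum>i\<in>F. \<bar>cmod (\<eta> i)\<bar> * \<bar>cmod (y i)\<bar>)"
    by (rule order_trans[OF norm_sum]) (simp add: norm_mult)
  also have "\<dots> \<le> e * L2_set (\<lambda>i. cmod (y i)) F" unfolding e_def by (rule L2_set_mult_ineq)
  also have "\<dots> \<le> e * (C * r)" by (intro mult_left_mono y nn)
  finally have "2 * cmod (\<Sum>i\<in>F. \<Sum>j\<in>F. \<eta> i * A i j * \<xi> j) \<le> C * (2 * e * r)" by (simp add: mult_ac)
  also have "\<dots> \<le> C * (e\<^sup>2 + r\<^sup>2)"
  proof (rule mult_left_mono)
    show "2 * e * r \<le> e\<^sup>2 + r\<^sup>2" using zero_le_power2[of "e - r"] unfolding power2_diff by linarith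
  qed fact
  also have "e\<^sup>2 + r\<^sup>2 = (\<Sum>i\<in>F. (cmod (\<eta> i))\<^sup>2) + (\<Sum>j\<in>F. (cmod (\<xi> j))\<^sup>2)"
    by (simp add: e_def r_def L2_set_def sum_nonneg)
  finally show "2 * cmod (\<Sum>i\<in>F. \<Sum>j\<in>F. \<eta> i * A i j * \<xi> j) \<le> sos_opnorm I A * ((\<Sum>i\<in>F. (cmod (\<eta> i))\<^sup>2) + (\<Sum>j\<in>F. (cmod (\<xi> j))\<^sup>2))"
    unfolding C_def .
qed

text \<open>The operator norm is itself a nonnegative form bound and lies below every other one, so
  it can be computed from upper and lower form estimates without touching the supremum.\<close>

lemma sos_opnorm_eqI:
  assumes "form_bounded I A C" "0 \<le> C" "\<And>i j. i \<notin> I \<or> j \<notin> I \<Longrightarrow> A i j = 0"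
    and "\<And>D. 0 \<le> D \<Longrightarrow> form_bounded I A D \<Longrightarrow> C \<le> D"
  shows "sos_opnorm I A = C"
proof (rule antisym)
  have "sos_bounded I A" by (rule form_bounded_imp_sos_bounded[OF assms(1-3)])
  then show "C \<le> sos_opnorm I A"
    by (intro assms(4) sos_opnorm_nonneg sos_bounded_imp_form_bounded)
qed (rule form_bounded_imp_sos_bounded[OF assms(1-3)])

text \<open>Enlarging a finite set only adds zero coordinates to the vectors. A bound therefore
  needs checking only on sets of convenient shape, such as products that split along an extra
  coordinate.\<close>

lemma form_bounded_cofinalI:
  assumes "\<And>F. finite F \<Longrightarrow> F \<subseteq> I \<Longrightarrow> \<exists>G. finite G \<and> F \<subseteq> G \<and> G \<subseteq> I \<and> (\<forall>\<eta> \<xi>.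
     2 * cmod (\<Sum>i\<in>G. \<Sum>j\<in>G. \<eta> i * A i j * \<xi> j) \<le> C * ((\<Sum>i\<in>G. (cmod (\<eta> i))\<^sup>2) + (\<Sum>j\<in>G. (cmod (\<xi> j))\<^sup>2)))"
  shows "form_bounded I A C"
proof (rule form_boundedI)
  fix F and \<eta> \<xi> :: "'a \<Rightarrow> complex" assume F: "finite F" "F \<subseteq> I"
  from assms[OF F] obtain G where G: "finite G" "F \<subseteq> G" "G \<subseteq> I" and
    b: "\<And>\<eta> \<xi>. 2 * cmod (\<Sum>i\<in>G. \<Sum>j\<in>G. \<eta> i * A i j * \<xi> j) \<le> C * ((\<Sum>i\<in>G. (cmod (\<eta> i))\<^sup>2) + (\<Sum>j\<in>G. (cmod (\<xi> j))\<^sup>2))"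
    by blast
  have "form_bounded G A C"
  proof (rule form_boundedI)
    fix F' and \<eta> \<xi> :: "'a \<Rightarrow> complex" assume F': "finite F'" "F' \<subseteq> G"
    let ?\<eta> = "\<lambda>i. if i \<in> F' then \<eta> i else 0" and ?\<xi> = "\<lambda>j. if j \<in> F' then \<xi> j else 0"
    have 1: "(\<Sum>j\<in>G. ?\<eta> i * A i j * ?\<xi> j) = (\<Sum>j\<in>F'. ?\<eta> i * A i j * \<xi> j)" for i
      by (rule sum.mono_neutral_cong_right) (use F' G in auto)
    have "(\<Sum>i\<in>G. \<Sum>j\<in>G. ?\<eta> i * A i j * ?\<xi> j) = (\<Sum>i\<in>F'. \<Sum>j\<in>F'. \<eta> i * A i j * \<xi> j)"
      unfolding 1 by (rule sum.mono_neutral_cong_right) (use F' G in auto)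
    moreover have "(\<Sum>i\<in>G. (cmod (?\<eta> i))\<^sup>2) = (\<Sum>i\<in>F'. (cmod (\<eta> i))\<^sup>2)"
      by (rule sum.mono_neutral_cong_right) (use F' G in auto)
    moreover have "(\<Sum>i\<in>G. (cmod (?\<xi> i))\<^sup>2) = (\<Sum>i\<in>F'. (cmod (\<xi> i))\<^sup>2)"
      by (rule sum.mono_neutral_cong_right) (use F' G in auto)
    ultimately show "2 * cmod (\<Sum>i\<in>F'. \<Sum>j\<in>F'. \<eta> i * A i j * \<xi> j) \<le> C * ((\<Sum>i\<in>F'. (cmod (\<eta> i))\<^sup>2) + (\<Sum>j\<in>F'. (cmod (\<xi> j))\<^sup>2))"
      using b[of ?\<eta> ?\<xi>] by simp
  qed
  then show "2 * cmod (\<Sum>i\<in>F. \<Sum>j\<in>F. \<eta> i * A i j * \<xi> j) \<le> C * ((\<Sum>i\<in>F. (cmod (\<eta> i))\<^sup>2) + (\<Sum>j\<in>F. (cmod (\<xi> j))\<^sup>2))"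
    using F G unfolding form_bounded_def by blast
qed

lemma form_bounded_reindex:
  assumes g: "bij_betw g I' I" and A': "\<And>i j. i \<in> I' \<Longrightarrow> j \<in> I' \<Longrightarrow> A' i j = A (g i) (g j)"
  shows "form_bounded I' A' C \<longleftrightarrow> form_bounded I A C"
proof -
  have inj: "inj_on g I'" and im: "g ` I' = I" using g by (auto simp: bij_betw_def)
  show ?thesis
  proof
    assume L: "form_bounded I' A' C"
    show "form_bounded I A C"
    proof (rule form_boundedI)
      fix F and \<eta> \<xi> :: "'b \<Rightarrow> complex" assume F: "finite F" "F \<subseteq> I"
      then obtain G where G: "G \<subseteq> I'" "F = g ` G" using im by (metis subset_imageE)
      have ig: "inj_on g G" using G inj by (auto intro: inj_on_subset)
      have fG: "finite G" using F G ig finite_imageD by blast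
      have "(\<Sum>i\<in>F. \<Sum>j\<in>F. \<eta> i * A i j * \<xi> j) = (\<Sum>i\<in>G. \<Sum>j\<in>G. \<eta> (g i) * A' i j * \<xi> (g j))"
        unfolding G(2) sum.reindex[OF ig] using A' G(1) by (auto intro!: sum.cong simp: subset_iff)
      moreover have "(\<Sum>i\<in>F. (cmod (h i))\<^sup>2) = (\<Sum>i\<in>G. (cmod (h (g i)))\<^sup>2)" for h
        unfolding G(2) sum.reindex[OF ig] by simp
      ultimately show "2 * cmod (\<Sum>i\<in>F. \<Sum>j\<in>F. \<eta> i * A i j * \<xi> j) \<le> C * ((\<Sum>i\<in>F. (cmod (\<eta> i))\<^sup>2) + (\<Sum>j\<in>F. (cmod (\<xi> j))\<^sup>2))"
        using L[unfolded form_bounded_def, rule_format, OF fG G(1), of "\<lambda>i. \<eta> (g i)" "\<lambda>i. \<xi> (g i)"] by simp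
    qed
  next
    assume R: "form_bounded I A C"
    show "form_bounded I' A' C"
    proof (rule form_boundedI)
      fix G and \<eta> \<xi> :: "'a \<Rightarrow> complex" assume G: "finite G" "G \<subseteq> I'"
      have ig: "inj_on g G" using G inj by (auto intro: inj_on_subset)
      let ?h = "inv_into I' g"
      have inv: "?h (g i) = i" if "i \<in> G" for i using that G inj by auto
      have "(\<Sum>i\<in>G. \<Sum>j\<in>G. \<eta> i * A' i j * \<xi> j) = (\<Sum>i\<in>g ` G. \<Sum>j\<in>g ` G. \<eta> (?h i) * A i j * \<xi> (?h j))"
        unfolding sum.reindex[OF ig] using A' G(2) inv by (auto intro!: sum.cong simp: subset_iff)
      moreover have "(\<Sum>i\<in>G. (cmod (h i))\<^sup>2) = (\<Sum>i\<in>g ` G. (cmod (h (?h i)))\<^sup>2)" for h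
        unfolding sum.reindex[OF ig] using inv by (auto intro!: sum.cong)
      moreover have "finite (g ` G)" "g ` G \<subseteq> I" using G im by auto
      ultimately show "2 * cmod (\<Sum>i\<in>G. \<Sum>j\<in>G. \<eta> i * A' i j * \<xi> j) \<le> C * ((\<Sum>i\<in>G. (cmod (\<eta> i))\<^sup>2) + (\<Sum>j\<in>G. (cmod (\<xi> j))\<^sup>2))"
        using R[unfolded form_bounded_def, rule_format, of "g ` G" "\<lambda>i. \<eta> (?h i)" "\<lambda>i. \<xi> (?h i)"] by simp
    qed
  qed
qed

lemma form_bounded_subset:
  "form_bounded I A C \<Longrightarrow> I' \<subseteq> I \<Longrightarrow> form_bounded I' A C"
  unfolding form_bounded_def by blast

text \<open>Conjugating the form exchanges \<open>\<eta>\<close> and \<open>\<xi>\<close>, and the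
  right-hand side of the bound is symmetric in them.\<close>

lemma form_bounded_adj:
  assumes "form_bounded I A C"
  shows "form_bounded I (sos_adj A) C"
proof (rule form_boundedI)
  fix F and \<eta> \<xi> :: "'a \<Rightarrow> complex" assume F: "finite F" "F \<subseteq> I"
  have "(\<Sum>i\<in>F. \<Sum>j\<in>F. \<eta> i * sos_adj A i j * \<xi> j) = cnj (\<Sum>j\<in>F. \<Sum>i\<in>F. cnj (\<xi> j) * A j i * cnj (\<eta> i))"
    by (subst sum.swap) (simp add: sos_adj_def mult_ac)
  then have "cmod (\<Sum>i\<in>F. \<Sum>j\<in>F. \<eta> i * sos_adj A i j * \<xi> j) = cmod (\<Sum>j\<in>F. \<Sum>i\<in>F. cnj (\<xi> j) * A j i * cnj (\<eta> i))"
    by (simp only: complex_mod_cnj)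
  then show "2 * cmod (\<Sum>i\<in>F. \<Sum>j\<in>F. \<eta> i * sos_adj A i j * \<xi> j) \<le> C * ((\<Sum>i\<in>F. (cmod (\<eta> i))\<^sup>2) + (\<Sum>j\<in>F. (cmod (\<xi> j))\<^sup>2))"
    using assms[unfolded form_bounded_def, rule_format, OF F, of "\<lambda>i. cnj (\<xi> i)" "\<lambda>i. cnj (\<eta> i)"]
    by (simp add: add.commute)
qed

section \<open>Complete isometries in terms of form bounds\<close>

lemma form_bounded_block_exists:
  assumes "\<And>k l. k < n \<Longrightarrow> l < n \<Longrightarrow> form_bounded I (T k l) (C k l)" "\<And>k l. 0 \<le> C k l"
  shows "form_bounded ({..<n} \<times> I) (sos_block n T) (\<Sum>k<n. \<Sum>l<n. C k l)"
proof (rule form_bounded_cofinalI)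
  fix F assume F: "finite F" "F \<subseteq> {..<n} \<times> I"
  define P where "P = snd ` F"
  have P: "finite P" "P \<subseteq> I" using F by (auto simp: P_def)
  let ?G = "{..<n} \<times> P"
  have "2 * cmod (\<Sum>i\<in>?G. \<Sum>j\<in>?G. \<eta> i * sos_block n T i j * \<xi> j)
        \<le> (\<Sum>k<n. \<Sum>l<n. C k l) * ((\<Sum>i\<in>?G. (cmod (\<eta> i))\<^sup>2) + (\<Sum>j\<in>?G. (cmod (\<xi> j))\<^sup>2))" for \<eta> \<xi>
  proof -
    let ?t = "\<lambda>k l. \<Sum>i\<in>P. \<Sum>j\<in>P. \<eta> (k, i) * T k l i j * \<xi> (l, j)"
    have "(\<Sum>i\<in>?G. \<Sum>j\<in>?G. \<eta> i * sos_block n T i j * \<xi> j)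
        = (\<Sum>k<n. \<Sum>i\<in>P. \<Sum>l<n. \<Sum>j\<in>P. \<eta> (k, i) * T k l i j * \<xi> (l, j))"
      by (simp add: sos_block_def sum.cartesian_product')
    also have "\<dots> = (\<Sum>k<n. \<Sum>l<n. ?t k l)"
      by (rule sum.cong[OF refl], rule sum.swap)
    finally have "2 * cmod (\<Sum>i\<in>?G. \<Sum>j\<in>?G. \<eta> i * sos_block n T i j * \<xi> j) = 2 * cmod (\<Sum>k<n. \<Sum>l<n. ?t k l)" by simp
    also have "\<dots> \<le> (\<Sum>k<n. \<Sum>l<n. 2 * cmod (?t k l))"
      unfolding sum_distrib_left[symmetric] by (intro mult_left_mono order_trans[OF norm_sum] sum_mono norm_sum) auto
    also have "\<dots> \<le> (\<Sum>k<n. \<Sum>l<n. C k l * ((\<Sum>i\<in>?G. (cmod (\<eta> i))\<^sup>2) + (\<Sum>j\<in>?G. (cmod (\<xi> j))\<^sup>2)))"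
    proof (intro sum_mono)
      fix k l assume kl: "k \<in> {..<n}" "l \<in> {..<n}"
      have sl: "(\<Sum>i\<in>P. (cmod (f (k, i)))\<^sup>2) \<le> (\<Sum>i\<in>?G. (cmod (f i))\<^sup>2)" if "k < n" for f :: "_ \<Rightarrow> complex" and k
      proof -
        have "(\<Sum>i\<in>P. (cmod (f (k, i)))\<^sup>2) = (\<Sum>i\<in>Pair k ` P. (cmod (f i))\<^sup>2)"
          by (subst sum.reindex) (auto simp: inj_on_def)
        also have "\<dots> \<le> (\<Sum>i\<in>?G. (cmod (f i))\<^sup>2)"
          using P that by (intro sum_mono2) auto
        finally show ?thesis .
      qed
      have "2 * cmod (?t k l) \<le> C k l * ((\<Sum>i\<in>P. (cmod (\<eta> (k, i)))\<^sup>2) + (\<Sum>j\<in>P. (cmod (\<xi> (l, j)))\<^sup>2))"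
        using kl P by (intro form_bounded_rect[OF assms(1)]) auto
      also have "\<dots> \<le> C k l * ((\<Sum>i\<in>?G. (cmod (\<eta> i))\<^sup>2) + (\<Sum>j\<in>?G. (cmod (\<xi> j))\<^sup>2))"
        using kl by (intro mult_left_mono add_mono sl assms(2)) auto
      finally show "2 * cmod (?t k l) \<le> C k l * ((\<Sum>i\<in>?G. (cmod (\<eta> i))\<^sup>2) + (\<Sum>j\<in>?G. (cmod (\<xi> j))\<^sup>2))" .
    qed
    finally show ?thesis by (simp only: sum_distrib_right)
  qed
  moreover have "finite ?G" "F \<subseteq> ?G" "?G \<subseteq> {..<n} \<times> I" using F P by (auto simp: P_def rev_image_eqI)
  ultimately show "\<exists>G. finite G \<and> F \<subseteq> G \<and> G \<subseteq> {..<n} \<times> I \<and> (\<forall>\<eta> \<xi>.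
     2 * cmod (\<Sum>i\<in>G. \<Sum>j\<in>G. \<eta> i * sos_block n T i j * \<xi> j)
      \<le> (\<Sum>k<n. \<Sum>l<n. C k l) * ((\<Sum>i\<in>G. (cmod (\<eta> i))\<^sup>2) + (\<Sum>j\<in>G. (cmod (\<xi> j))\<^sup>2)))"
    by blast
qed

text \<open>The two estimates pin down the block norm. Boundedness of a single operator is the 1 x 1
  case of \<open>up\<close>, where the block index merely attaches the label 0.\<close>

lemma ci_mapI:
  assumes z: "\<And>x i j. i \<notin> I \<or> j \<notin> I \<Longrightarrow> \<phi> x i j = 0"
    and lin: "\<And>x y. \<phi> (x + y) = (\<lambda>i j. \<phi> x i j + \<phi> y i j)" "\<And>c x. \<phi> (sc c x) = (\<lambda>i j. c * \<phi> x i j)"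
    and nn: "\<And>n X. 0 \<le> N n X"
    and up: "\<And>n X. form_bounded ({..<n} \<times> I) (sos_block n (\<lambda>k l. \<phi> (X k l))) (N n X)"
    and lo: "\<And>n X D. 0 \<le> D \<Longrightarrow> form_bounded ({..<n} \<times> I) (sos_block n (\<lambda>k l. \<phi> (X k l))) D \<Longrightarrow> N n X \<le> D"
  shows "ci_map sc N I \<phi>"
proof -
  have "sos_bounded I (\<phi> x)" for x
  proof -
    have "bij_betw (Pair (0::nat)) I ({..<1} \<times> I)" by (auto simp: bij_betw_def inj_on_def)
    then have "form_bounded I (\<phi> x) (N 1 (\<lambda>_ _. x)) \<longleftrightarrow> form_bounded ({..<1} \<times> I) (sos_block 1 (\<lambda>k l. \<phi> x)) (N 1 (\<lambda>_ _. x))"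
      by (rule form_bounded_reindex) (auto simp: sos_block_def)
    with up[of 1 "\<lambda>_ _. x"] have "form_bounded I (\<phi> x) (N 1 (\<lambda>_ _. x))" by simp
    then show ?thesis using z nn by (intro form_bounded_imp_sos_bounded)
  qed
  moreover have "sos_matnorm I n (\<lambda>k l. \<phi> (X k l)) = N n X" for n X
    unfolding sos_matnorm_def
  proof (rule sos_opnorm_eqI[OF up nn])
    show "i \<notin> {..<n} \<times> I \<or> j \<notin> {..<n} \<times> I \<Longrightarrow> sos_block n (\<lambda>k l. \<phi> (X k l)) i j = 0" for i j
      using z by (auto simp: sos_block_def split: prod.split)
  qed (rule lo)
  ultimately show ?thesis unfolding ci_map_def using lin by blast
qed

lemma ci_map_form_bounded:
  assumes ci: "ci_map sc N I \<phi>"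
  shows "form_bounded ({..<n} \<times> I) (sos_block n (\<lambda>k l. \<phi> (X k l))) (N n X)"
    and "0 \<le> D \<Longrightarrow> form_bounded ({..<n} \<times> I) (sos_block n (\<lambda>k l. \<phi> (X k l))) D \<Longrightarrow> N n X \<le> D"
    and "0 \<le> N n X"
    and "i \<notin> I \<or> j \<notin> I \<Longrightarrow> \<phi> x i j = 0"
proof -
  have b: "sos_bounded I (\<phi> x)" for x using ci by (simp add: ci_map_def)
  show z: "i \<notin> I \<or> j \<notin> I \<Longrightarrow> \<phi> x i j = 0" for i j x using b unfolding sos_bounded_def by blast
  have zb: "i \<notin> {..<n} \<times> I \<or> j \<notin> {..<n} \<times> I \<Longrightarrow> sos_block n (\<lambda>k l. \<phi> (X k l)) i j = 0" for i j
    using z by (auto simp: sos_block_def split: prod.split)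
  have N: "N n X = sos_opnorm ({..<n} \<times> I) (sos_block n (\<lambda>k l. \<phi> (X k l)))"
    using ci by (simp add: ci_map_def sos_matnorm_def)
  \<comment> \<open>The crude sum of entry norms only secures boundedness of the block matrix;
    without that the supremum behind \<open>N n X\<close> would carry no information.\<close>
  have fb: "form_bounded ({..<n} \<times> I) (sos_block n (\<lambda>k l. \<phi> (X k l))) (\<Sum>k<n. \<Sum>l<n. sos_opnorm I (\<phi> (X k l)))"
    by (intro form_bounded_block_exists sos_bounded_imp_form_bounded sos_opnorm_nonneg b)
  have sb: "sos_bounded ({..<n} \<times> I) (sos_block n (\<lambda>k l. \<phi> (X k l)))"
    by (rule form_bounded_imp_sos_bounded[OF fb _ zb]) (auto intro!: sum_nonneg sos_opnorm_nonneg b)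
  show "form_bounded ({..<n} \<times> I) (sos_block n (\<lambda>k l. \<phi> (X k l))) (N n X)"
    unfolding N by (rule sos_bounded_imp_form_bounded[OF sb])
  show "0 \<le> N n X" unfolding N by (rule sos_opnorm_nonneg[OF sb])
  show "N n X \<le> D" if "0 \<le> D" "form_bounded ({..<n} \<times> I) (sos_block n (\<lambda>k l. \<phi> (X k l))) D"
    unfolding N by (rule form_bounded_imp_sos_bounded(2)[OF that(2,1) zb])
qed

section \<open>Dilation to twice the index set\<close>

text \<open>\<open>a\<close> and \<open>b\<close> are the rows of a real orthogonal 2 x 2 matrix.
  Row and column relations are both recorded: the columns give Parseval's identity, the rows the
  compression to one summand.\<close>

definition orthogonal2 :: "(bool \<Rightarrow> real) \<Rightarrow> (bool \<Rightarrow> real) \<Rightarrow> bool" where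
  "orthogonal2 a b \<longleftrightarrow>
     (a True)\<^sup>2 + (a False)\<^sup>2 = 1 \<and> (b True)\<^sup>2 + (b False)\<^sup>2 = 1 \<and> a True * b True + a False * b False = 0 \<and>
     (a True)\<^sup>2 + (b True)\<^sup>2 = 1 \<and> (a False)\<^sup>2 + (b False)\<^sup>2 = 1 \<and> a True * a False + b True * b False = 0"

lemma orthogonal2_parseval:
  assumes "orthogonal2 a b"
  shows "(cmod (of_real (a True) * x + of_real (a False) * y))\<^sup>2
       + (cmod (of_real (b True) * x + of_real (b False) * y))\<^sup>2 = (cmod x)\<^sup>2 + (cmod y)\<^sup>2"
proof -
  have *: "(a True * u + a False * v)\<^sup>2 + (b True * u + b False * v)\<^sup>2 = u\<^sup>2 + v\<^sup>2" for u v :: real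
  proof -
    have "(a True * u + a False * v)\<^sup>2 + (b True * u + b False * v)\<^sup>2
       = ((a True)\<^sup>2 + (b True)\<^sup>2) * u\<^sup>2 + ((a False)\<^sup>2 + (b False)\<^sup>2) * v\<^sup>2 + 2 * (a True * a False + b True * b False) * (u * v)"
      by (simp add: power2_eq_square algebra_simps)
    then show ?thesis using assms unfolding orthogonal2_def by simp
  qed
  show ?thesis using *[of "Re x" "Re y"] *[of "Im x" "Im y"] by (simp add: cmod_power2)
qed

text \<open>As a matrix over the Boolean coordinate, \<open>M\<close> is the transpose of the
  rotation with rows \<open>a\<close>, \<open>b\<close>, times diag(A, B), times the rotation with
  rows \<open>c\<close>, \<open>d\<close>. The rotations move over to the vectors.\<close>

lemma form_dilation_eq:
  fixes M :: "'i \<times> bool \<Rightarrow> 'i \<times> bool \<Rightarrow> complex"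
  assumes M: "\<And>p s q t. M (p, s) (q, t) = of_real (a s * c t) * A p q + of_real (b s * d t) * B p q"
  shows "(\<Sum>i\<in>P \<times> UNIV. \<Sum>j\<in>P \<times> UNIV. \<eta> i * M i j * \<xi> j)
    = (\<Sum>p\<in>P. \<Sum>q\<in>P. (of_real (a True) * \<eta> (p, True) + of_real (a False) * \<eta> (p, False)) * A p q
          * (of_real (c True) * \<xi> (q, True) + of_real (c False) * \<xi> (q, False)))
    + (\<Sum>p\<in>P. \<Sum>q\<in>P. (of_real (b True) * \<eta> (p, True) + of_real (b False) * \<eta> (p, False)) * B p q
          * (of_real (d True) * \<xi> (q, True) + of_real (d False) * \<xi> (q, False)))"
proof -
  have "(\<Sum>i\<in>P \<times> UNIV. \<Sum>j\<in>P \<times> UNIV. \<eta> i * M i j * \<xi> j)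
      = (\<Sum>p\<in>P. \<Sum>s\<in>UNIV. \<Sum>q\<in>P. \<Sum>t\<in>UNIV. \<eta> (p, s) * M (p, s) (q, t) * \<xi> (q, t))"
    by (simp only: sum.cartesian_product')
  also have "\<dots> = (\<Sum>p\<in>P. \<Sum>q\<in>P. \<Sum>s\<in>UNIV. \<Sum>t\<in>UNIV. \<eta> (p, s) * M (p, s) (q, t) * \<xi> (q, t))"
    by (rule sum.cong[OF refl], rule sum.swap)
  finally show ?thesis
    unfolding sum.distrib[symmetric] by (simp add: M UNIV_bool algebra_simps)
qed

text \<open>By Parseval the squared norms split exactly into the parts seen by \<open>A\<close> and
  by \<open>B\<close>, so the two bounds add up with the same constant.\<close>

lemma form_bounded_dilation:
  assumes M: "\<And>p s q t. M (p, s) (q, t) = of_real (a s * c t) * A p q + of_real (b s * d t) * B p q"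
    and ab: "orthogonal2 a b" and cd: "orthogonal2 c d"
    and A: "form_bounded I A C" and B: "form_bounded I B C"
  shows "form_bounded (I \<times> UNIV) M C"
proof (rule form_bounded_cofinalI)
  fix F :: "('a \<times> bool) set" assume F: "finite F" "F \<subseteq> I \<times> UNIV"
  define P where "P = fst ` F"
  have P: "finite P" "P \<subseteq> I" using F by (auto simp: P_def)
  let ?G = "P \<times> (UNIV :: bool set)"
  have "2 * cmod (\<Sum>i\<in>?G. \<Sum>j\<in>?G. \<eta> i * M i j * \<xi> j)
        \<le> C * ((\<Sum>i\<in>?G. (cmod (\<eta> i))\<^sup>2) + (\<Sum>j\<in>?G. (cmod (\<xi> j))\<^sup>2))" for \<eta> \<xi>
  proof -
    define \<eta>1 where "\<eta>1 p = of_real (a True) * \<eta> (p, True) + of_real (a False) * \<eta> (p, False)" for p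
    define \<eta>2 where "\<eta>2 p = of_real (b True) * \<eta> (p, True) + of_real (b False) * \<eta> (p, False)" for p
    define \<xi>1 where "\<xi>1 p = of_real (c True) * \<xi> (p, True) + of_real (c False) * \<xi> (p, False)" for p
    define \<xi>2 where "\<xi>2 p = of_real (d True) * \<xi> (p, True) + of_real (d False) * \<xi> (p, False)" for p
    have n1: "(\<Sum>i\<in>?G. (cmod (\<eta> i))\<^sup>2) = (\<Sum>p\<in>P. (cmod (\<eta>1 p))\<^sup>2) + (\<Sum>p\<in>P. (cmod (\<eta>2 p))\<^sup>2)"
      unfolding \<eta>1_def \<eta>2_def sum.distrib[symmetric] orthogonal2_parseval[OF ab]
      by (simp add: UNIV_bool add.commute sum.cartesian_product')
    have n2: "(\<Sum>i\<in>?G. (cmod (\<xi> i))\<^sup>2) = (\<Sum>p\<in>P. (cmod (\<xi>1 p))\<^sup>2) + (\<Sum>p\<in>P. (cmod (\<xi>2 p))\<^sup>2)"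
      unfolding \<xi>1_def \<xi>2_def sum.distrib[symmetric] orthogonal2_parseval[OF cd]
      by (simp add: UNIV_bool add.commute sum.cartesian_product')
    have "2 * cmod (\<Sum>i\<in>?G. \<Sum>j\<in>?G. \<eta> i * M i j * \<xi> j)
        = 2 * cmod ((\<Sum>p\<in>P. \<Sum>q\<in>P. \<eta>1 p * A p q * \<xi>1 q) + (\<Sum>p\<in>P. \<Sum>q\<in>P. \<eta>2 p * B p q * \<xi>2 q))"
      unfolding form_dilation_eq[of M a c A b d B, OF M] \<eta>1_def \<eta>2_def \<xi>1_def \<xi>2_def by simp
    also have "\<dots> \<le> 2 * cmod (\<Sum>p\<in>P. \<Sum>q\<in>P. \<eta>1 p * A p q * \<xi>1 q) + 2 * cmod (\<Sum>p\<in>P. \<Sum>q\<in>P. \<eta>2 p * B p q * \<xi>2 q)"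
      unfolding distrib_left[symmetric] by (intro mult_left_mono norm_triangle_ineq) simp
    also have "\<dots> \<le> C * ((\<Sum>p\<in>P. (cmod (\<eta>1 p))\<^sup>2) + (\<Sum>p\<in>P. (cmod (\<xi>1 p))\<^sup>2)) + C * ((\<Sum>p\<in>P. (cmod (\<eta>2 p))\<^sup>2) + (\<Sum>p\<in>P. (cmod (\<xi>2 p))\<^sup>2))"
      by (intro add_mono form_bounded_rect[OF A] form_bounded_rect[OF B] P)
    finally show ?thesis unfolding n1 n2 by (simp only: distrib_left add_ac)
  qed
  moreover have "finite ?G" "F \<subseteq> ?G" "?G \<subseteq> I \<times> UNIV" using F P by (auto simp: P_def rev_image_eqI)
  ultimately show "\<exists>G. finite G \<and> F \<subseteq> G \<and> G \<subseteq> I \<times> UNIV \<and> (\<forall>\<eta> \<xi>.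
     2 * cmod (\<Sum>i\<in>G. \<Sum>j\<in>G. \<eta> i * M i j * \<xi> j) \<le> C * ((\<Sum>i\<in>G. (cmod (\<eta> i))\<^sup>2) + (\<Sum>j\<in>G. (cmod (\<xi> j))\<^sup>2)))"
    by blast
qed

text \<open>Vectors of the shape \<open>a s * \<eta> p\<close> and \<open>c s * \<xi> p\<close> have
  unchanged norm, and orthogonality of the rows makes them invisible to \<open>B\<close>.\<close>

lemma form_bounded_compression:
  assumes M: "\<And>p s q t. M (p, s) (q, t) = of_real (a s * c t) * A p q + of_real (b s * d t) * B p q"
    and ab: "orthogonal2 a b" and cd: "orthogonal2 c d"
    and MB: "form_bounded (I \<times> UNIV) M C"
  shows "form_bounded I A C"
proof (rule form_boundedI)
  fix F and \<eta> \<xi> :: "'a \<Rightarrow> complex" assume F: "finite F" "F \<subseteq> I"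
  let ?\<eta> = "\<lambda>(p, s). of_real (a s) * \<eta> p" and ?\<xi> = "\<lambda>(p, s). of_real (c s) * \<xi> p"
  let ?G = "F \<times> (UNIV :: bool set)"
  have e: "of_real (f True) * (of_real (f True) * x) + of_real (f False) * (of_real (f False) * x) = x"
          "of_real (g True) * (of_real (f True) * x) + of_real (g False) * (of_real (f False) * x) = 0"
    if "orthogonal2 f g" for f g and x :: complex
  proof -
    have "of_real (f True) * (of_real (f True) * x) + of_real (f False) * (of_real (f False) * x) = of_real ((f True)\<^sup>2 + (f False)\<^sup>2) * x"
      by (simp add: power2_eq_square algebra_simps)
    then show "of_real (f True) * (of_real (f True) * x) + of_real (f False) * (of_real (f False) * x) = x"
      using that by (simp only: orthogonal2_def of_real_1 mult_1)
    have "of_real (g True) * (of_real (f True) * x) + of_real (g False) * (of_real (f False) * x) = of_real (f True * g True + f False * g False) * x"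
      by (simp add: algebra_simps)
    then show "of_real (g True) * (of_real (f True) * x) + of_real (g False) * (of_real (f False) * x) = 0"
      using that by (simp only: orthogonal2_def of_real_0 mult_zero_left)
  qed
  have n: "(\<Sum>i\<in>?G. (cmod (case i of (p, s) \<Rightarrow> of_real (f s) * h p))\<^sup>2) = (\<Sum>p\<in>F. (cmod (h p))\<^sup>2)"
    if "orthogonal2 f g" for f g and h :: "'a \<Rightarrow> complex"
  proof -
    have "(cmod (of_real (f True) * x))\<^sup>2 + (cmod (of_real (f False) * x))\<^sup>2 = (cmod x)\<^sup>2" for x
    proof -
      have "(cmod (of_real (f True) * x))\<^sup>2 + (cmod (of_real (f False) * x))\<^sup>2 = ((f True)\<^sup>2 + (f False)\<^sup>2) * (cmod x)\<^sup>2"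
        by (simp add: norm_mult power_mult_distrib algebra_simps)
      then show ?thesis using that by (simp only: orthogonal2_def mult_1)
    qed
    then show ?thesis by (simp add: UNIV_bool add.commute sum.cartesian_product')
  qed
  have "(\<Sum>i\<in>?G. \<Sum>j\<in>?G. ?\<eta> i * M i j * ?\<xi> j) = (\<Sum>p\<in>F. \<Sum>q\<in>F. \<eta> p * A p q * \<xi> q)"
    unfolding form_dilation_eq[of M a c A b d B, OF M] by (simp only: case_prod_conv e[OF ab] e[OF cd] mult_zero_left sum.neutral_const add_0_right)
  moreover have "finite ?G" "?G \<subseteq> I \<times> UNIV" using F by auto
  ultimately show "2 * cmod (\<Sum>i\<in>F. \<Sum>j\<in>F. \<eta> i * A i j * \<xi> j) \<le> C * ((\<Sum>i\<in>F. (cmod (\<eta> i))\<^sup>2) + (\<Sum>j\<in>F. (cmod (\<xi> j))\<^sup>2))"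
    using MB[unfolded form_bounded_def, rule_format, of ?G ?\<eta> ?\<xi>] by (simp add: n[OF ab] n[OF cd])
qed

text \<open>The antiisometry gives the second summand the same norm bound as the first, and
  compression to the first gives the lower bound. The pair \<open>(pr, sg)\<close> leaves open how
  the index type encodes the doubling, since the two applications use different types.\<close>

lemma ci_map_dilation:
  fixes pr :: "'k \<Rightarrow> 'i" and sg :: "'k \<Rightarrow> bool" and sc :: "complex \<Rightarrow> 'v \<Rightarrow> 'v::ab_group_add"
  assumes ci: "ci_map sc N I \<psi>" and st: "ca_involution sc N st"
    and bij: "bij (\<lambda>j. (pr j, sg j))" and ab: "orthogonal2 a b" and cd: "orthogonal2 c d"
  shows "ci_map sc N {j. pr j \<in> I} (\<lambda>x j k. of_real (a (sg j) * c (sg k)) * \<psi> x (pr j) (pr k)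
           + of_real (b (sg j) * d (sg k)) * sos_adj (\<psi> (st x)) (pr j) (pr k))"
    (is "ci_map sc N ?J ?\<Phi>")
proof (rule ci_mapI)
  note cib = ci_map_form_bounded[OF ci]
  show "?\<Phi> x j k = 0" if "j \<notin> ?J \<or> k \<notin> ?J" for x j k using cib(4) that by (auto simp: sos_adj_def)
  have st1: "st (x + y) = st x + st y" "st (sc z x) = sc (cnj z) (st x)" for x y z
    using st by (auto simp: ca_involution_def)
  have psi: "\<psi> (x + y) = (\<lambda>i j. \<psi> x i j + \<psi> y i j)" "\<psi> (sc z x) = (\<lambda>i j. z * \<psi> x i j)" for x y z
    using ci by (auto simp: ci_map_def)
  show "?\<Phi> (x + y) = (\<lambda>i j. ?\<Phi> x i j + ?\<Phi> y i j)" for x y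
    by (intro ext) (simp add: st1 psi sos_adj_def algebra_simps)
  show "?\<Phi> (sc z x) = (\<lambda>i j. z * ?\<Phi> x i j)" for z x
    by (intro ext) (simp add: st1 psi sos_adj_def algebra_simps)
  show "0 \<le> N n X" for n X by (rule cib(3))
  \<comment> \<open>The Boolean coordinate is moved outermost, so that the block matrix becomes a
    dilation of block matrices.\<close>
  define g :: "nat \<times> 'k \<Rightarrow> (nat \<times> 'i) \<times> bool" where "g = (\<lambda>(k, j). ((k, pr j), sg j))"
  have g: "bij_betw g ({..<n} \<times> ?J) (({..<n} \<times> I) \<times> UNIV)" for n
  proof -
    have inj: "j = k" if "pr j = pr k" "sg j = sg k" for j k
      using injD[OF bij_is_inj[OF bij], of j k] that by simp
    have surj: "\<exists>j. pr j = p \<and> sg j = s" for p s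
      using surjD[OF bij_is_surj[OF bij], of "(p, s)"] by auto
    show ?thesis
    proof (rule bij_betw_imageI)
      show "inj_on g ({..<n} \<times> ?J)" by (auto simp: inj_on_def g_def intro: inj)
      have "((k, p), s) \<in> g ` ({..<n} \<times> ?J)" if "k < n" "p \<in> I" for k p s
      proof -
        obtain j where "pr j = p" "sg j = s" using surj by blast
        then show ?thesis using that by (intro image_eqI[of _ _ "(k, j)"]) (auto simp: g_def)
      qed
      then show "g ` ({..<n} \<times> ?J) = ({..<n} \<times> I) \<times> UNIV" by (auto simp: g_def)
    qed
  qed
  fix n and X :: "nat \<Rightarrow> nat \<Rightarrow> 'v"
  \<comment> \<open>Taking the adjoint of a block matrix also transposes the blocks; with
    \<open>X l k\<close> inside, the block at \<open>(k, l)\<close> is again built from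
    \<open>X k l\<close>.\<close>
  let ?A = "sos_block n (\<lambda>k l. \<psi> (X k l))" and ?B = "sos_adj (sos_block n (\<lambda>k l. \<psi> (st (X l k))))"
  define M where "M = (\<lambda>(p, s) (q, t). of_real (a s * c t) * ?A p q + of_real (b s * d t) * ?B p q)"
  have M: "M (p, s) (q, t) = of_real (a s * c t) * ?A p q + of_real (b s * d t) * ?B p q" for p s q t
    by (simp add: M_def)
  have eq: "form_bounded ({..<n} \<times> ?J) (sos_block n (\<lambda>k l. ?\<Phi> (X k l))) D \<longleftrightarrow> form_bounded (({..<n} \<times> I) \<times> UNIV) M D" for D
    by (rule form_bounded_reindex[OF g]) (auto simp: M_def g_def sos_block_def sos_adj_def)
  have A: "form_bounded ({..<n} \<times> I) ?A (N n X)" by (rule cib(1))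
  have "N n (\<lambda>k l. st (X l k)) = N n X" using st by (simp add: ca_involution_def)
  with cib(1)[of n "\<lambda>k l. st (X l k)"] have B: "form_bounded ({..<n} \<times> I) ?B (N n X)"
    by (intro form_bounded_adj) simp
  show "form_bounded ({..<n} \<times> ?J) (sos_block n (\<lambda>k l. ?\<Phi> (X k l))) (N n X)"
    unfolding eq by (rule form_bounded_dilation[of M, OF M ab cd A B])
  show "N n X \<le> D" if "0 \<le> D" "form_bounded ({..<n} \<times> ?J) (sos_block n (\<lambda>k l. ?\<Phi> (X k l))) D" for D
    using form_bounded_compression[of M, OF M ab cd that(2)[unfolded eq]] cib(2) that(1) by blast
qed

section \<open>Hahn-Banach separation for cones with an order unit\<close>

text \<open>Homogeneity is required as an inequality only, which is what passes directly to infima;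
  equality follows by rescaling with \<open>1 / c\<close>.\<close>

definition sublinear :: "(real \<Rightarrow> 'a \<Rightarrow> 'a::ab_group_add) \<Rightarrow> ('a \<Rightarrow> real) \<Rightarrow> bool" where
  "sublinear sc p \<longleftrightarrow> (\<forall>x y. p (x + y) \<le> p x + p y) \<and> (\<forall>c x. 0 \<le> c \<longrightarrow> p (sc c x) \<le> c * p x)"

lemma sublinearD:
  assumes "vector_space sc" "sublinear sc p"
  shows "p (x + y) \<le> p x + p y" "0 \<le> c \<Longrightarrow> p (sc c x) = c * p x" "p 0 = 0" "- p (- x) \<le> p x"
proof -
  interpret vector_space sc by fact
  show add: "p (x + y) \<le> p x + p y" for x y using assms(2) unfolding sublinear_def by blast
  have sca: "p (sc c x) \<le> c * p x" if "0 \<le> c" for c x using assms(2) that unfolding sublinear_def by blast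
  show p0: "p 0 = 0" using add[of 0 0] sca[of 0 0] by simp
  show "p (sc c x) = c * p x" if "0 \<le> c"
  proof (cases "c = 0")
    case True then show ?thesis using p0 by simp
  next
    case False
    then have "p (sc (1/c) (sc c x)) \<le> (1/c) * p (sc c x)" using that by (intro sca) auto
    then have "c * p x \<le> p (sc c x)" using False that by (simp add: field_simps)
    then show ?thesis using sca[OF that] by (intro antisym)
  qed
  show "- p (- x) \<le> p x" using add[of x "- x"] p0 by simp
qed

text \<open>Infimum over t >= 0 of p(x + t y) - t p(y).  A minimal sublinear functional is unchanged by
  this shift for every y, hence odd, hence linear.\<close>
lemma sublinear_shift:
  assumes vs: "vector_space sc" and p: "sublinear sc p"
  obtains p' where "sublinear sc p'" "p' \<le> p" "p' (- y) \<le> - p y"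
proof -
  interpret vector_space sc by fact
  note pD = sublinearD[OF vs p]
  define p' where "p' x = (INF t\<in>{0..}. p (x + sc t y) - t * p y)" for x
  \<comment> \<open>Subadditivity gives t p(y) = p(t y) \<le> p(x + t y) + p(- x), a lower bound
    independent of t.\<close>
  have bdd: "bdd_below ((\<lambda>t. p (x + sc t y) - t * p y) ` {0..})" for x
  proof (rule bdd_belowI2)
    fix t :: real assume "t \<in> {0..}"
    then show "- p (- x) \<le> p (x + sc t y) - t * p y"
      using pD(1)[of "x + sc t y" "- x"] pD(2)[of t y] by simp
  qed
  have le: "p' x \<le> p (x + sc t y) - t * p y" if "0 \<le> t" for x t
    unfolding p'_def using that by (intro cINF_lower bdd) auto
  have "sublinear sc p'"
    unfolding sublinear_def
  proof (intro conjI allI impI)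
    fix x z
    \<comment> \<open>A shift \<open>t\<close> for \<open>x\<close> and a shift \<open>s\<close> for
      \<open>z\<close> combine to the shift \<open>t + s\<close> for the sum; the infimum is taken
      over \<open>s\<close> first, then over \<open>t\<close>.\<close>
    have "p' (x + z) - (p (x + sc t y) - t * p y) \<le> p' z" if "0 \<le> t" for t
      unfolding p'_def[of z]
    proof (rule cINF_greatest)
      fix s :: real assume s: "s \<in> {0..}"
      have "p' (x + z) \<le> p (x + z + sc (t + s) y) - (t + s) * p y" using that s by (intro le) auto
      also have "x + z + sc (t + s) y = (x + sc t y) + (z + sc s y)" by (simp add: scale_left_distrib algebra_simps)
      also have "p \<dots> \<le> p (x + sc t y) + p (z + sc s y)" by (rule pD)
      finally show "p' (x + z) - (p (x + sc t y) - t * p y) \<le> p (z + sc s y) - s * p y"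
        by (simp add: algebra_simps)
    qed simp
    then have "p' (x + z) - p' z \<le> p (x + sc t y) - t * p y" if "0 \<le> t" for t
      using that by (smt (verit))
    then have "p' (x + z) - p' z \<le> p' x"
      unfolding p'_def[of x] by (intro cINF_greatest) auto
    then show "p' (x + z) \<le> p' x + p' z" by simp
  next
    fix c :: real and x assume c: "0 \<le> c"
    show "p' (sc c x) \<le> c * p' x"
    proof (cases "c = 0")
      case True
      then show ?thesis using le[of 0 0] pD(3) by simp
    next
      case False
      then have "c > 0" using c by simp
      have "p' (sc c x) / c \<le> p' x"
        unfolding p'_def[of x]
      proof (rule cINF_greatest)
        fix t :: real assume t: "t \<in> {0..}"
        have "p' (sc c x) \<le> p (sc c x + sc (c * t) y) - c * t * p y" using c t by (intro le) auto
        also have "sc c x + sc (c * t) y = sc c (x + sc t y)" by (simp add: scale_right_distrib)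
        also have "p \<dots> = c * p (x + sc t y)" by (rule pD(2)[OF c])
        finally show "p' (sc c x) / c \<le> p (x + sc t y) - t * p y"
          using \<open>c > 0\<close> by (simp add: field_simps)
      qed simp
      then show ?thesis using \<open>c > 0\<close> by (simp add: field_simps)
    qed
  qed
  moreover have "p' \<le> p" using le[of 0] by (auto simp: le_fun_def)
  moreover have "p' (- y) \<le> - p y" using le[of 1 "- y"] pD(3) by simp
  ultimately show ?thesis by (rule that)
qed

text \<open>Zorn's lemma for the reversed pointwise order; the pointwise infimum of a chain is again
  sublinear.\<close>

lemma sublinear_minimal_exists:
  assumes vs: "vector_space sc" and q: "sublinear sc q"
  obtains p where "sublinear sc p" "p \<le> q" "\<And>p'. sublinear sc p' \<Longrightarrow> p' \<le> p \<Longrightarrow> p' = p"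
proof -
  interpret vector_space sc by fact
  define A where "A = {p. sublinear sc p \<and> p \<le> q}"
  have "\<exists>m\<in>A. \<forall>a\<in>A. a \<le> m \<longrightarrow> a = m"
  proof (rule predicate_Zorn)
    show "partial_order_on A (relation_of (\<lambda>x y. y \<le> x) A)"
      unfolding partial_order_on_def preorder_on_def refl_on_def trans_def antisym_def relation_of_def
      by (auto intro: order_trans)
  next
    fix C assume "C \<in> Chains (relation_of (\<lambda>x y. y \<le> x) A)"
    then have CA: "C \<subseteq> A" and ch: "\<And>p p'. p \<in> C \<Longrightarrow> p' \<in> C \<Longrightarrow> p \<le> p' \<or> p' \<le> p"
      unfolding Chains_def relation_of_def by auto
    show "\<exists>u\<in>A. \<forall>a\<in>C. u \<le> a"
    proof (cases "C = {}")
      case True then show ?thesis using q by (auto simp: A_def)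
    next
      case False
      have C: "sublinear sc p" "p \<le> q" if "p \<in> C" for p using CA that by (auto simp: A_def)
      define u where "u x = (INF p\<in>C. p x)" for x
      \<comment> \<open>Every \<open>p\<close> in the chain satisfies
        \<open>p x \<ge> - p (- x) \<ge> - q (- x)\<close>.\<close>
      have bdd: "bdd_below ((\<lambda>p. p x) ` C)" for x
      proof (rule bdd_belowI2)
        fix p assume "p \<in> C"
        then show "- q (- x) \<le> p x"
          using sublinearD(4)[OF vs C(1), of p x] C(2)[of p] by (auto simp: le_fun_def) (smt (verit))
      qed
      have le: "u x \<le> p x" if "p \<in> C" for p x unfolding u_def by (rule cINF_lower[OF bdd that])
      have "sublinear sc u"
        unfolding sublinear_def
      proof (intro conjI allI impI)
        fix x y
        have *: "u (x + y) \<le> p x + p' y" if pp: "p \<in> C" "p' \<in> C" for p p'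
        proof -
          \<comment> \<open>An infimum of sublinear functionals need not be subadditive; for a
            chain, one member lies below both competitors.\<close>
          have "\<exists>r\<in>C. r \<le> p \<and> r \<le> p'" using ch[OF pp] pp by auto
          then obtain r where r: "r \<in> C" "r \<le> p" "r \<le> p'" by blast
          have "u (x + y) \<le> r (x + y)" by (rule le[OF r(1)])
          also have "\<dots> \<le> r x + r y" by (rule sublinearD(1)[OF vs C(1)[OF r(1)]])
          also have "\<dots> \<le> p x + p' y" using r by (auto simp: le_fun_def intro: add_mono)
          finally show ?thesis .
        qed
        have "u (x + y) - p x \<le> u y" if "p \<in> C" for p
          unfolding u_def[of y] using *[OF that] False by (intro cINF_greatest) (auto simp: algebra_simps)
        then have "u (x + y) - u y \<le> u x"
          unfolding u_def[of x] using False by (intro cINF_greatest) (auto simp: algebra_simps)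
        then show "u (x + y) \<le> u x + u y" by simp
      next
        fix c :: real and x assume c: "0 \<le> c"
        have p: "u (sc c x) \<le> c * p x" if "p \<in> C" for p
          using le[OF that, of "sc c x"] sublinearD(2)[OF vs C(1)[OF that] c] by simp
        show "u (sc c x) \<le> c * u x"
        proof (cases "c = 0")
          case True then show ?thesis using p False by auto
        next
          case c0: False
          have "u (sc c x) / c \<le> u x"
            unfolding u_def[of x] using False c c0 p by (intro cINF_greatest) (auto simp: field_simps)
          then show ?thesis using c c0 by (simp add: field_simps)
        qed
      qed
      moreover have "u \<le> q"
      proof -
        from False obtain p where "p \<in> C" by blast
        have "u \<le> p" using le[OF \<open>p \<in> C\<close>] by (simp add: le_fun_def)
        also have "p \<le> q" by (rule C(2)[OF \<open>p \<in> C\<close>])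
        finally show ?thesis .
      qed
      ultimately show ?thesis using le by (auto simp: A_def le_fun_def)
    qed
  qed
  then obtain p where "p \<in> A" "\<And>a. a \<in> A \<Longrightarrow> a \<le> p \<Longrightarrow> a = p" by blast
  then show ?thesis using that[of p] by (auto simp: A_def intro: order_trans)
qed

text \<open>One shift by \<open>y\<close> before minimising builds in the value at \<open>y\<close>:
  everything below \<open>q'\<close> is at most \<open>- q y\<close> at \<open>- y\<close>, hence at
  least \<open>q y\<close> at \<open>y\<close> once it is odd. This replaces extension from the line
  through \<open>y\<close>.\<close>

lemma hahn_banach_sublinear:
  assumes vs: "vector_space sc" and q: "sublinear sc q"
  obtains L where "\<And>x y. L (x + y) = L x + L y" "\<And>c x. L (sc c x) = c * L x" "L \<le> q" "q y \<le> L y"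
proof -
  interpret vector_space sc by fact
  obtain q' where q': "sublinear sc q'" "q' \<le> q" "q' (- y) \<le> - q y"
    using sublinear_shift[OF vs q] .
  obtain L where L: "sublinear sc L" "L \<le> q'" and min: "\<And>p'. sublinear sc p' \<Longrightarrow> p' \<le> L \<Longrightarrow> p' = L"
    using sublinear_minimal_exists[OF vs q'(1)] by metis
  note LD = sublinearD[OF vs L(1)]
  have neg: "L (- x) = - L x" for x
  proof -
    obtain p' where "sublinear sc p'" "p' \<le> L" "p' (- x) \<le> - L x"
      using sublinear_shift[OF vs L(1)] .
    with min have "L (- x) \<le> - L x" by blast
    with LD(4)[of x] show ?thesis by simp
  qed
  \<comment> \<open>Subadditivity at \<open>x, z\<close> and at \<open>- x, - z\<close>, joined by
    oddness, gives both inequalities.\<close>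
  have add: "L (x + z) = L x + L z" for x z
    using LD(1)[of x z] LD(1)[of "- x" "- z"] neg[of x] neg[of z] neg[of "x + z"] by simp
  have sca: "L (sc c x) = c * L x" for c x
  proof (cases "0 \<le> c")
    case True then show ?thesis by (rule LD)
  next
    case False
    then have "L (sc (- c) x) = - c * L x" by (intro LD) auto
    then show ?thesis using neg[of "sc c x"] by simp
  qed
  have "L \<le> q" using L(2) q'(2) by (rule order_trans)
  moreover have "L (- y) \<le> q' (- y)" using L(2) by (auto simp: le_fun_def)
  with q'(3) neg[of y] have "q y \<le> L y" by simp
  ultimately show ?thesis using add sca that by blast
qed

text \<open>The sublinear functional is the gauge: the infimum of all \<open>t\<close> with
  \<open>t e - s\<close> in \<open>K\<close>. It is at most 0 at \<open>- s\<close> for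
  \<open>s\<close> in \<open>K\<close>, at most 1 at \<open>e\<close> and at most -1 at
  \<open>- e\<close>, so any linear \<open>L\<close> below it is positive with
  \<open>L e = 1\<close>.\<close>

lemma cone_functional_exists:
  fixes sc :: "real \<Rightarrow> 'a \<Rightarrow> 'a::ab_group_add"
  assumes vs: "vector_space sc"
    and Kadd: "\<And>x y. x \<in> K \<Longrightarrow> y \<in> K \<Longrightarrow> x + y \<in> K"
    and Ksc: "\<And>c x. 0 \<le> c \<Longrightarrow> x \<in> K \<Longrightarrow> sc c x \<in> K"
    and absorb: "\<And>s. \<exists>t. sc t e - s \<in> K"
    and bound: "\<And>t. sc t e - y \<in> K \<Longrightarrow> r \<le> t"
  obtains L where "\<And>x y. L (x + y) = L x + L y" "\<And>c x. L (sc c x) = c * L x"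
    "\<And>s. s \<in> K \<Longrightarrow> 0 \<le> L s" "L e = (1::real)" "r \<le> L y"
proof -
  interpret vector_space sc by fact
  \<comment> \<open>The hypothesis \<open>bound\<close> also keeps the cone proper: a negative
    multiple of \<open>e\<close> in \<open>K\<close> could be added repeatedly to push the
    coefficient below \<open>r\<close>.\<close>
  have pos: "0 \<le> t" if t: "sc t e \<in> K" for t
  proof (rule ccontr)
    assume n: "\<not> 0 \<le> t"
    obtain t0 where t0: "sc t0 e - y \<in> K" using absorb by blast
    \<comment> \<open>Chosen so that \<open>l * t + t0 = r - 1\<close>.\<close>
    define l where "l = (t0 - r + 1) / (- t)"
    have l: "0 \<le> l" using n bound[OF t0] unfolding l_def by (intro divide_nonneg_pos) auto
    have "sc l (sc t e) + (sc t0 e - y) \<in> K" by (rule Kadd[OF Ksc[OF l t] t0])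
    moreover have "sc l (sc t e) + (sc t0 e - y) = sc (l * t + t0) e - y" by (simp add: scale_left_distrib)
    moreover have "l * t + t0 = r - 1" using n by (simp add: l_def)
    ultimately have "sc (r - 1) e - y \<in> K" by metis
    from bound[OF this] show False by simp
  qed
  have zero: "0 \<in> K"
  proof -
    obtain t where "sc t e - 0 \<in> K" using absorb by blast
    from Ksc[OF _ this, of 0] show ?thesis by simp
  qed
  define q where "q s = Inf {t. sc t e - s \<in> K}" for s
  have ne: "{t. sc t e - s \<in> K} \<noteq> {}" for s using absorb by blast
  have bdd: "bdd_below {t. sc t e - s \<in> K}" for s
  proof -
    obtain u where u: "sc u e - (- s) \<in> K" using absorb by blast
    have "- u \<le> t" if "sc t e - s \<in> K" for t
    proof -
      have "(sc t e - s) + (sc u e - (- s)) \<in> K" by (rule Kadd[OF that u])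
      also have "(sc t e - s) + (sc u e - (- s)) = sc (t + u) e" by (simp add: scale_left_distrib)
      finally show ?thesis using pos[of "t + u"] by simp
    qed
    then show ?thesis by (intro bdd_belowI[where m = "- u"]) simp
  qed
  have le: "q s \<le> t" if "sc t e - s \<in> K" for s t
    unfolding q_def using that by (intro cInf_lower bdd) auto
  have "sublinear sc q"
    unfolding sublinear_def
  proof (intro conjI allI impI)
    fix x z
    have *: "q (x + z) \<le> t + u" if "sc t e - x \<in> K" "sc u e - z \<in> K" for t u
    proof (rule le)
      have "(sc t e - x) + (sc u e - z) \<in> K" by (rule Kadd[OF that])
      then show "sc (t + u) e - (x + z) \<in> K" by (simp add: scale_left_distrib algebra_simps)
    qed
    have "q (x + z) - t \<le> q z" if "sc t e - x \<in> K" for t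
      unfolding q_def[of z] using *[OF that] ne by (intro cInf_greatest) (auto simp: algebra_simps)
    then have "q (x + z) - q z \<le> q x"
      unfolding q_def[of x] using ne by (intro cInf_greatest) (auto simp: algebra_simps)
    then show "q (x + z) \<le> q x + q z" by simp
  next
    fix c :: real and x assume c: "0 \<le> c"
    have *: "q (sc c x) \<le> c * t" if "sc t e - x \<in> K" for t
      using Ksc[OF c that] by (intro le) (simp add: scale_right_diff_distrib)
    show "q (sc c x) \<le> c * q x"
    proof (cases "c = 0")
      case True then show ?thesis using * ne by auto
    next
      case c0: False
      have "q (sc c x) / c \<le> q x"
        unfolding q_def[of x] using ne c c0 * by (intro cInf_greatest) (auto simp: field_simps)
      then show ?thesis using c c0 by (simp add: field_simps)
    qed
  qed
  from hahn_banach_sublinear[OF vs this, of y] obtain L where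
    L: "\<And>x y. L (x + y) = L x + L y" "\<And>c x. L (sc c x) = c * L x" "L \<le> q" "q y \<le> L y" by blast
  have neg: "L (- x) = - L x" for x using L(2)[of "-1" x] by simp
  have Lq: "L x \<le> q x" for x using L(3) by (auto simp: le_fun_def)
  have "r \<le> q y" unfolding q_def using ne bound by (intro cInf_greatest) auto
  then have "r \<le> L y" using L(4) by simp
  moreover have "0 \<le> L s" if "s \<in> K" for s
    using Lq[of "- s"] le[of 0 "- s"] that neg[of s] by simp
  moreover have "L e = 1"
    using Lq[of e] le[of 1 e] Lq[of "- e"] le[of "-1" "- e"] neg[of e] zero by simp
  ultimately show ?thesis using that L(1,2) by blast
qed

section \<open>The cone of Ruan's theorem\<close>

definition scaled :: "complex \<Rightarrow> (nat \<Rightarrow> complex) \<Rightarrow> nat \<Rightarrow> complex" where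
  "scaled c f = (\<lambda>i. c * f i)"

text \<open>Only the real part is kept, so positivity concerns the Hermitian part of
  \<open>a\<close> and no selfadjointness has to be carried along.\<close>

definition quad_form :: "nat \<Rightarrow> (nat \<Rightarrow> nat \<Rightarrow> complex) \<Rightarrow> (nat \<Rightarrow> complex) \<Rightarrow> real" where
  "quad_form n a \<xi> = Re (\<Sum>i<n. \<Sum>j<n. cnj (\<xi> i) * a i j * \<xi> j)"

definition rank_one :: "(nat \<Rightarrow> complex) \<Rightarrow> (nat \<Rightarrow> complex) \<Rightarrow> nat \<Rightarrow> nat \<Rightarrow> complex" where
  "rank_one \<alpha> \<beta> = (\<lambda>i j. \<alpha> i * cnj (\<beta> j))"

definition std_basis :: "nat \<Rightarrow> nat \<Rightarrow> complex" where
  "std_basis k = (\<lambda>i. if i = k then 1 else 0)"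

lemma quad_form_add: "quad_form n (a + b) \<xi> = quad_form n a \<xi> + quad_form n b \<xi>"
  by (simp add: quad_form_def algebra_simps sum.distrib)

lemma quad_form_scale: "quad_form n (\<lambda>i j. of_real c * a i j) \<xi> = c * quad_form n a \<xi>"
proof -
  have "(\<Sum>i<n. \<Sum>j<n. cnj (\<xi> i) * (of_real c * a i j) * \<xi> j) = of_real c * (\<Sum>i<n. \<Sum>j<n. cnj (\<xi> i) * a i j * \<xi> j)"
    by (simp add: sum_distrib_left mult_ac)
  then show ?thesis by (simp add: quad_form_def)
qed

lemma quad_form_zero: "quad_form n 0 \<xi> = 0"
  by (simp add: quad_form_def)

lemma quad_form_sum: "quad_form n (\<lambda>i j. \<Sum>p\<in>S. a p i j) \<xi> = (\<Sum>p\<in>S. quad_form n (a p) \<xi>)"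
proof (induction S rule: infinite_finite_induct)
  case (insert p S)
  have "(\<lambda>i j. \<Sum>p\<in>insert p S. a p i j) = a p + (\<lambda>i j. \<Sum>p\<in>S. a p i j)"
    using insert by (auto simp: fun_eq_iff)
  then show ?case using insert by (simp add: quad_form_add)
qed (simp_all add: quad_form_def)

lemma quad_form_adj: "quad_form n (sos_adj a) \<xi> = quad_form n a \<xi>"
proof -
  have "(\<Sum>i<n. \<Sum>j<n. cnj (\<xi> i) * sos_adj a i j * \<xi> j) = cnj (\<Sum>i<n. \<Sum>j<n. cnj (\<xi> i) * a i j * \<xi> j)"
    by (subst sum.swap) (simp add: sos_adj_def mult_ac)
  then show ?thesis unfolding quad_form_def by (simp only: cnj.sel)
qed

lemma quad_form_rank_one: "quad_form n (rank_one \<alpha> \<alpha>) \<xi> = (cmod (\<Sum>i<n. \<alpha> i * cnj (\<xi> i)))\<^sup>2"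
proof -
  have "(\<Sum>i<n. \<Sum>j<n. cnj (\<xi> i) * rank_one \<alpha> \<alpha> i j * \<xi> j) = (\<Sum>i<n. \<alpha> i * cnj (\<xi> i)) * cnj (\<Sum>i<n. \<alpha> i * cnj (\<xi> i))"
    by (simp add: rank_one_def sum_product mult_ac)
  then show ?thesis unfolding quad_form_def complex_norm_square[symmetric] by (simp only: Re_complex_of_real)
qed

text \<open>A crude entrywise constant suffices, since it only has to make the identity absorb every
  matrix.\<close>

lemma quad_form_le: "quad_form n a \<xi> \<le> (\<Sum>i<n. \<Sum>j<n. cmod (a i j)) * (\<Sum>i<n. (cmod (\<xi> i))\<^sup>2)"
proof -
  let ?Z = "\<Sum>i<n. (cmod (\<xi> i))\<^sup>2"
  have "quad_form n a \<xi> \<le> cmod (\<Sum>i<n. \<Sum>j<n. cnj (\<xi> i) * a i j * \<xi> j)"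
    unfolding quad_form_def by (rule complex_Re_le_cmod)
  also have "\<dots> \<le> (\<Sum>i<n. \<Sum>j<n. cmod (cnj (\<xi> i) * a i j * \<xi> j))"
    by (intro order_trans[OF norm_sum] sum_mono norm_sum)
  also have "\<dots> \<le> (\<Sum>i<n. \<Sum>j<n. cmod (a i j) * ?Z)"
  proof (intro sum_mono)
    fix i j assume ij: "i \<in> {..<n}" "j \<in> {..<n}"
    have le: "(cmod (\<xi> k))\<^sup>2 \<le> ?Z" if "k \<in> {..<n}" for k
      by (rule member_le_sum) (use that in auto)
    have "0 \<le> (cmod (\<xi> i) - cmod (\<xi> j))\<^sup>2" by simp
    then have "cmod (\<xi> i) * cmod (\<xi> j) \<le> ?Z" using le[OF ij(1)] le[OF ij(2)] unfolding power2_diff by linarith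
    then have "cmod (a i j) * (cmod (\<xi> i) * cmod (\<xi> j)) \<le> cmod (a i j) * ?Z" by (rule mult_left_mono) simp
    then show "cmod (cnj (\<xi> i) * a i j * \<xi> j) \<le> cmod (a i j) * ?Z" by (simp add: norm_mult mult_ac)
  qed
  finally show ?thesis by (simp add: sum_distrib_right)
qed

text \<open>Written as a sum of rank-one matrices so that the normalisation of the functional
  becomes a sum of diagonal values of the two forms.\<close>

definition ident_mat :: "nat \<Rightarrow> nat \<Rightarrow> nat \<Rightarrow> complex" where
  "ident_mat n = (\<lambda>i j. \<Sum>k<n. rank_one (std_basis k) (std_basis k) i j)"

lemma quad_form_ident: "quad_form n (ident_mat n) \<xi> = (\<Sum>i<n. (cmod (\<xi> i))\<^sup>2)"
proof -
  have "quad_form n (ident_mat n) \<xi> = (\<Sum>k<n. quad_form n (rank_one (std_basis k) (std_basis k)) \<xi>)"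
    unfolding ident_mat_def by (rule quad_form_sum)
  also have "\<dots> = (\<Sum>k<n. (cmod (\<xi> k))\<^sup>2)"
  proof (rule sum.cong)
    fix k assume k: "k \<in> {..<n}"
    have "(\<Sum>i<n. std_basis k i * cnj (\<xi> i)) = (\<Sum>i<n. if i = k then cnj (\<xi> i) else 0)"
      by (intro sum.cong) (auto simp: std_basis_def)
    then show "quad_form n (rank_one (std_basis k) (std_basis k)) \<xi> = (cmod (\<xi> k))\<^sup>2"
      using k by (simp add: quad_form_rank_one)
  qed simp
  finally show ?thesis .
qed

lemma sum_lessThan_add:
  fixes f :: "nat \<Rightarrow> 'a::comm_monoid_add"
  shows "(\<Sum>p<m + n. f p) = (\<Sum>p<m. f p) + (\<Sum>p<n. f (m + p))"
  by (induction n) (simp_all add: add_ac)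

text \<open>The second claim also rests on the estimate: the supremum dominates its member 0 because
  the set is bounded.\<close>

lemma sos_cmatnorm_le:
  assumes "\<And>\<xi>. (\<Sum>i<n. (cmod (\<Sum>j<m. \<alpha> i j * \<xi> j))\<^sup>2) \<le> t * (\<Sum>j<m. (cmod (\<xi> j))\<^sup>2)" "0 \<le> t"
  shows "sos_cmatnorm n m \<alpha> \<le> sqrt t" "0 \<le> sos_cmatnorm n m \<alpha>"
proof -
  let ?S = "{sqrt (\<Sum>i<n. (cmod (\<Sum>j<m. \<alpha> i j * \<xi> j))\<^sup>2) | \<xi>. (\<Sum>j<m. (cmod (\<xi> j))\<^sup>2) \<le> 1}"
  have le: "v \<le> sqrt t" if "v \<in> ?S" for v
  proof -
    from that obtain \<xi> where \<xi>: "v = sqrt (\<Sum>i<n. (cmod (\<Sum>j<m. \<alpha> i j * \<xi> j))\<^sup>2)" "(\<Sum>j<m. (cmod (\<xi> j))\<^sup>2) \<le> 1" by blast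
    have "t * (\<Sum>j<m. (cmod (\<xi> j))\<^sup>2) \<le> t" using \<xi>(2) assms(2) by (simp add: mult_left_le)
    then show ?thesis unfolding \<xi>(1) using assms(1)[of \<xi>] by (intro real_sqrt_le_mono) simp
  qed
  have mem: "0 \<in> ?S" by (rule CollectI, rule exI[of _ "\<lambda>_. 0"]) simp
  show "sos_cmatnorm n m \<alpha> \<le> sqrt t"
    unfolding sos_cmatnorm_def using mem le by (intro cSup_least) blast+
  show "0 \<le> sos_cmatnorm n m \<alpha>"
    unfolding sos_cmatnorm_def using mem le by (intro cSup_upper bdd_aboveI[where M = "sqrt t"])
qed

text \<open>An operator and its adjoint have the same norm: the squared norm \<open>Y\<close> of the
  image pairs \<open>\<xi>\<close> with \<open>z\<close>, so Cauchy-Schwarz bounds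
  \<open>Y^2\<close> by the squared norm of \<open>\<xi>\<close> times \<open>t * Y\<close>, and one
  factor \<open>Y\<close> cancels.\<close>

lemma transpose_bound:
  fixes \<alpha> :: "nat \<Rightarrow> nat \<Rightarrow> complex"
  assumes "\<And>\<xi>. (\<Sum>p<m. (cmod (\<Sum>i<n. \<alpha> p i * cnj (\<xi> i)))\<^sup>2) \<le> t * (\<Sum>i<n. (cmod (\<xi> i))\<^sup>2)" "0 \<le> t"
  shows "(\<Sum>i<n. (cmod (\<Sum>p<m. \<alpha> p i * \<xi> p))\<^sup>2) \<le> t * (\<Sum>p<m. (cmod (\<xi> p))\<^sup>2)"
proof -
  define y where "y i = (\<Sum>p<m. \<alpha> p i * \<xi> p)" for i
  define z where "z p = (\<Sum>i<n. \<alpha> p i * cnj (y i))" for p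
  define Y where "Y = (\<Sum>i<n. (cmod (y i))\<^sup>2)"
  have Y0: "0 \<le> Y" by (simp add: Y_def sum_nonneg)
  have "of_real Y = (\<Sum>i<n. y i * cnj (y i))" by (simp only: Y_def of_real_sum complex_norm_square)
  also have "\<dots> = (\<Sum>p<m. \<xi> p * z p)"
    unfolding y_def[of _] z_def sum_distrib_left sum_distrib_right by (subst sum.swap) (simp add: mult_ac y_def)
  finally have "Y = cmod (\<Sum>p<m. \<xi> p * z p)" using Y0 by (metis abs_of_nonneg norm_of_real)
  also have "\<dots> \<le> (\<Sum>p<m. \<bar>cmod (\<xi> p)\<bar> * \<bar>cmod (z p)\<bar>)"
    by (rule order_trans[OF norm_sum]) (simp add: norm_mult)
  also have "\<dots> \<le> L2_set (\<lambda>p. cmod (\<xi> p)) {..<m} * L2_set (\<lambda>p. cmod (z p)) {..<m}"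
    by (rule L2_set_mult_ineq)
  also have "\<dots> \<le> L2_set (\<lambda>p. cmod (\<xi> p)) {..<m} * sqrt (t * Y)"
    unfolding L2_set_def[of "\<lambda>p. cmod (z p)"] using assms(1)[of y]
    by (intro mult_left_mono real_sqrt_le_mono) (auto simp: z_def Y_def)
  finally have "Y\<^sup>2 \<le> (L2_set (\<lambda>p. cmod (\<xi> p)) {..<m} * sqrt (t * Y))\<^sup>2"
    using Y0 by (rule power_mono)
  also have "\<dots> = (\<Sum>p<m. (cmod (\<xi> p))\<^sup>2) * (t * Y)"
    using Y0 assms(2) by (simp add: power_mult_distrib L2_set_def sum_nonneg)
  finally have "Y * Y \<le> (t * (\<Sum>p<m. (cmod (\<xi> p))\<^sup>2)) * Y" by (simp add: power2_eq_square mult_ac)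
  then have "Y \<le> t * (\<Sum>p<m. (cmod (\<xi> p))\<^sup>2)"
    using Y0 assms(2) by (cases "Y = 0") (auto simp: sum_nonneg)
  then show ?thesis unfolding Y_def y_def .
qed

section \<open>Abstract operator spaces and the separating cone\<close>

locale operator_space =
  fixes sc :: "complex \<Rightarrow> 'v \<Rightarrow> 'v::ab_group_add" and N :: "nat \<Rightarrow> (nat \<Rightarrow> nat \<Rightarrow> 'v) \<Rightarrow> real"
  assumes op_space: "abstract_operator_space sc N"
begin

sublocale vector_space sc
  using op_space by (simp add: abstract_operator_space_def)

lemma N_cong: "(\<And>i j. i < n \<Longrightarrow> j < n \<Longrightarrow> x i j = y i j) \<Longrightarrow> N n x = N n y"
  by (rule op_space[unfolded abstract_operator_space_def, THEN conjunct2, THEN conjunct1, rule_format])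

lemma N_nonneg: "0 \<le> N n x"
  by (rule op_space[unfolded abstract_operator_space_def, THEN conjunct2, THEN conjunct2, THEN conjunct1, rule_format])

lemma N_eq_0: "N n x = 0 \<longleftrightarrow> (\<forall>i<n. \<forall>j<n. x i j = 0)"
  by (rule op_space[unfolded abstract_operator_space_def, THEN conjunct2, THEN conjunct2, THEN conjunct2, THEN conjunct1, rule_format])

lemma N_scale: "N n (\<lambda>i j. sc c (x i j)) = cmod c * N n x"
  by (rule op_space[unfolded abstract_operator_space_def, THEN conjunct2, THEN conjunct2, THEN conjunct2, THEN conjunct2, THEN conjunct2, THEN conjunct1, rule_format])

lemma N_mmul: "N n (sos_mmul sc m \<alpha> x \<beta>) \<le> sos_cmatnorm n m \<alpha> * N m x * sos_cmatnorm m n \<beta>"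
  by (rule op_space[unfolded abstract_operator_space_def, THEN conjunct2, THEN conjunct2, THEN conjunct2, THEN conjunct2, THEN conjunct2, THEN conjunct2, THEN conjunct1, rule_format])

lemma N_dsum: "N (n + m) (sos_dsum n x y) = max (N n x) (N m y)"
  by (rule op_space[unfolded abstract_operator_space_def, THEN conjunct2, THEN conjunct2, THEN conjunct2, THEN conjunct2, THEN conjunct2, THEN conjunct2, THEN conjunct2, rule_format])

text \<open>The product of \<open>X\<close> with a left factor whose columns are the vectors
  \<open>\<alpha> p\<close> and a right factor whose rows are the conjugates of
  \<open>\<beta> q\<close>. Factors stored as families of vectors can be concatenated for direct
  sums.\<close>

definition sandwich :: "nat \<Rightarrow> (nat \<Rightarrow> nat \<Rightarrow> 'v) \<Rightarrow> (nat \<Rightarrow> nat \<Rightarrow> complex) \<Rightarrow> (nat \<Rightarrow> nat \<Rightarrow> complex) \<Rightarrow> nat \<Rightarrow> nat \<Rightarrow> 'v" where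
  "sandwich m X \<alpha> \<beta> = (\<lambda>i j. \<Sum>p<m. \<Sum>q<m. sc (rank_one (\<alpha> p) (\<beta> q) i j) (X p q))"

text \<open>The bimodule axiom with a factor \<open>sqrt t\<close> from either side. The hypothesis
  on \<open>\<alpha>\<close> bounds the adjoint of the left factor and so passes through
  \<open>transpose_bound\<close>; the one on \<open>\<beta>\<close> bounds the right factor
  directly.\<close>

lemma N_sandwich:
  assumes "\<And>\<xi>. (\<Sum>p<m. (cmod (\<Sum>i<n. \<alpha> p i * cnj (\<xi> i)))\<^sup>2) \<le> t * (\<Sum>i<n. (cmod (\<xi> i))\<^sup>2)"
    and "\<And>\<xi>. (\<Sum>p<m. (cmod (\<Sum>i<n. \<beta> p i * cnj (\<xi> i)))\<^sup>2) \<le> t * (\<Sum>i<n. (cmod (\<xi> i))\<^sup>2)"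
    and t: "0 \<le> t"
  shows "N n (sandwich m X \<alpha> \<beta>) \<le> t * N m X"
proof -
  let ?a = "\<lambda>i p. \<alpha> p i" and ?b = "\<lambda>q j. cnj (\<beta> q j)"
  note a = sos_cmatnorm_le[where n = n and m = m and \<alpha> = ?a, OF transpose_bound[OF assms(1) t] t]
  have "(\<Sum>q<m. (cmod (\<Sum>j<n. ?b q j * \<xi> j))\<^sup>2) \<le> t * (\<Sum>j<n. (cmod (\<xi> j))\<^sup>2)" for \<xi>
  proof -
    have "(\<Sum>j<n. ?b q j * \<xi> j) = cnj (\<Sum>j<n. \<beta> q j * cnj (\<xi> j))" for q by simp
    then have "cmod (\<Sum>j<n. ?b q j * \<xi> j) = cmod (\<Sum>j<n. \<beta> q j * cnj (\<xi> j))" for q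
      by (simp only: complex_mod_cnj)
    then show ?thesis using assms(2)[of \<xi>] by simp
  qed
  note b = sos_cmatnorm_le[where n = m and m = n and \<alpha> = ?b, OF this t]
  have "N n (sandwich m X \<alpha> \<beta>) = N n (sos_mmul sc m ?a X ?b)"
    by (rule N_cong) (simp add: sandwich_def sos_mmul_def rank_one_def)
  also have "\<dots> \<le> sos_cmatnorm n m ?a * N m X * sos_cmatnorm m n ?b" by (rule N_mmul)
  also have "\<dots> \<le> sqrt t * N m X * sqrt t"
    by (intro mult_mono a b mult_nonneg_nonneg N_nonneg t real_sqrt_ge_zero order_refl)
  also have "\<dots> = (sqrt t * sqrt t) * N m X" by (simp only: mult_ac)
  also have "\<dots> = t * N m X" using t by simp
  finally show ?thesis .
qed

text \<open>The order relations are expressed by quadratic forms, and the inner size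
  \<open>m\<close> is existentially quantified. Entries of \<open>v\<close> outside the n x n corner
  are left free.\<close>

definition ruan_cone :: "nat \<Rightarrow> ((nat \<Rightarrow> nat \<Rightarrow> complex) \<times> (nat \<Rightarrow> nat \<Rightarrow> 'v) \<times> (nat \<Rightarrow> nat \<Rightarrow> complex)) set" where
  "ruan_cone n = {(a, v, b). \<exists>m X \<alpha> \<beta>. N m X \<le> 1 \<and> (\<forall>i<n. \<forall>j<n. v i j = sandwich m X \<alpha> \<beta> i j) \<and>
     (\<forall>\<xi>. (\<Sum>p<m. (cmod (\<Sum>i<n. \<alpha> p i * cnj (\<xi> i)))\<^sup>2) \<le> quad_form n a \<xi>) \<and>
     (\<forall>\<xi>. (\<Sum>p<m. (cmod (\<Sum>i<n. \<beta> p i * cnj (\<xi> i)))\<^sup>2) \<le> quad_form n b \<xi>)}"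

lemma ruan_coneI:
  assumes "N m X \<le> 1" "\<And>i j. i < n \<Longrightarrow> j < n \<Longrightarrow> v i j = sandwich m X \<alpha> \<beta> i j"
     "\<And>\<xi>. (\<Sum>p<m. (cmod (\<Sum>i<n. \<alpha> p i * cnj (\<xi> i)))\<^sup>2) \<le> quad_form n a \<xi>"
     "\<And>\<xi>. (\<Sum>p<m. (cmod (\<Sum>i<n. \<beta> p i * cnj (\<xi> i)))\<^sup>2) \<le> quad_form n b \<xi>"
  shows "(a, v, b) \<in> ruan_cone n"
  unfolding ruan_cone_def mem_Collect_eq prod.case
  by (rule exI[of _ m], rule exI[of _ X], rule exI[of _ \<alpha>], rule exI[of _ \<beta>]) (use assms in blast)

lemma ruan_coneE:
  assumes "(a, v, b) \<in> ruan_cone n"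
  obtains m X \<alpha> \<beta> where "N m X \<le> 1" "\<And>i j. i < n \<Longrightarrow> j < n \<Longrightarrow> v i j = sandwich m X \<alpha> \<beta> i j"
     "\<And>\<xi>. (\<Sum>p<m. (cmod (\<Sum>i<n. \<alpha> p i * cnj (\<xi> i)))\<^sup>2) \<le> quad_form n a \<xi>"
     "\<And>\<xi>. (\<Sum>p<m. (cmod (\<Sum>i<n. \<beta> p i * cnj (\<xi> i)))\<^sup>2) \<le> quad_form n b \<xi>"
  using assms unfolding ruan_cone_def by blast

definition rscale :: "real \<Rightarrow> (nat \<Rightarrow> nat \<Rightarrow> complex) \<times> (nat \<Rightarrow> nat \<Rightarrow> 'v) \<times> (nat \<Rightarrow> nat \<Rightarrow> complex) \<Rightarrow> (nat \<Rightarrow> nat \<Rightarrow> complex) \<times> (nat \<Rightarrow> nat \<Rightarrow> 'v) \<times> (nat \<Rightarrow> nat \<Rightarrow> complex)" where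
  "rscale c = (\<lambda>(a, v, b). (\<lambda>i j. of_real c * a i j, \<lambda>i j. sc (of_real c) (v i j), \<lambda>i j. of_real c * b i j))"

lemma vector_space_rscale: "vector_space rscale"
  by unfold_locales
    (simp_all add: rscale_def case_prod_beta prod_eq_iff fun_eq_iff algebra_simps)

text \<open>The direct-sum axiom: the direct sum of two middle matrices of norm at most 1 has norm
  at most 1, and concatenating the outer vectors adds all three components.\<close>

lemma ruan_cone_add:
  assumes "s \<in> ruan_cone n" "s' \<in> ruan_cone n"
  shows "s + s' \<in> ruan_cone n"
proof -
  obtain a v b a' v' b' where s: "s = (a, v, b)" "s' = (a', v', b')" by (metis prod_cases3)
  from ruan_coneE[OF assms(1)[unfolded s]] obtain m1 X1 \<alpha>1 \<beta>1 where
    1: "N m1 X1 \<le> 1" "\<And>i j. i < n \<Longrightarrow> j < n \<Longrightarrow> v i j = sandwich m1 X1 \<alpha>1 \<beta>1 i j"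
     "\<And>\<xi>. (\<Sum>p<m1. (cmod (\<Sum>i<n. \<alpha>1 p i * cnj (\<xi> i)))\<^sup>2) \<le> quad_form n a \<xi>"
     "\<And>\<xi>. (\<Sum>p<m1. (cmod (\<Sum>i<n. \<beta>1 p i * cnj (\<xi> i)))\<^sup>2) \<le> quad_form n b \<xi>" by blast
  from ruan_coneE[OF assms(2)[unfolded s]] obtain m2 X2 \<alpha>2 \<beta>2 where
    2: "N m2 X2 \<le> 1" "\<And>i j. i < n \<Longrightarrow> j < n \<Longrightarrow> v' i j = sandwich m2 X2 \<alpha>2 \<beta>2 i j"
     "\<And>\<xi>. (\<Sum>p<m2. (cmod (\<Sum>i<n. \<alpha>2 p i * cnj (\<xi> i)))\<^sup>2) \<le> quad_form n a' \<xi>"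
     "\<And>\<xi>. (\<Sum>p<m2. (cmod (\<Sum>i<n. \<beta>2 p i * cnj (\<xi> i)))\<^sup>2) \<le> quad_form n b' \<xi>" by blast
  let ?\<alpha> = "\<lambda>p. if p < m1 then \<alpha>1 p else \<alpha>2 (p - m1)" and ?\<beta> = "\<lambda>p. if p < m1 then \<beta>1 p else \<beta>2 (p - m1)"
  have "(a + a', v + v', b + b') \<in> ruan_cone n"
  proof (rule ruan_coneI)
    show "N (m1 + m2) (sos_dsum m1 X1 X2) \<le> 1" using 1(1) 2(1) by (simp add: N_dsum)
    show "(v + v') i j = sandwich (m1 + m2) (sos_dsum m1 X1 X2) ?\<alpha> ?\<beta> i j" if "i < n" "j < n" for i j
      using 1(2)[OF that] 2(2)[OF that] by (simp add: sandwich_def sum_lessThan_add sos_dsum_def)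
    show "(\<Sum>p<m1 + m2. (cmod (\<Sum>i<n. ?\<alpha> p i * cnj (\<xi> i)))\<^sup>2) \<le> quad_form n (a + a') \<xi>" for \<xi>
      using add_mono[OF 1(3)[of \<xi>] 2(3)[of \<xi>]] by (simp add: sum_lessThan_add quad_form_add)
    show "(\<Sum>p<m1 + m2. (cmod (\<Sum>i<n. ?\<beta> p i * cnj (\<xi> i)))\<^sup>2) \<le> quad_form n (b + b') \<xi>" for \<xi>
      using add_mono[OF 1(4)[of \<xi>] 2(4)[of \<xi>]] by (simp add: sum_lessThan_add quad_form_add)
  qed
  then show ?thesis by (simp add: s)
qed

lemma sandwich_scaled:
  "sandwich m X (\<lambda>p. scaled c (\<alpha> p)) (\<lambda>p. scaled d (\<beta> p)) = (\<lambda>i j. sc (c * cnj d) (sandwich m X \<alpha> \<beta> i j))"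
  by (simp add: sandwich_def rank_one_def scaled_def scale_sum_right mult_ac)

lemma norm_scaled_sum:
  "(\<Sum>p<m. (cmod (\<Sum>i<n. scaled c (\<alpha> p) i * cnj (\<xi> i)))\<^sup>2) = (cmod c)\<^sup>2 * (\<Sum>p<m. (cmod (\<Sum>i<n. \<alpha> p i * cnj (\<xi> i)))\<^sup>2)"
proof -
  have "(\<Sum>i<n. scaled c (\<alpha> p) i * cnj (\<xi> i)) = c * (\<Sum>i<n. \<alpha> p i * cnj (\<xi> i))" for p
    by (simp add: scaled_def sum_distrib_left mult_ac)
  then show ?thesis by (simp only: norm_mult power_mult_distrib sum_distrib_left[symmetric])
qed

lemma ruan_cone_scale:
  assumes "0 \<le> c" "s \<in> ruan_cone n"
  shows "rscale c s \<in> ruan_cone n"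
proof -
  obtain a v b where s: "s = (a, v, b)" by (metis prod_cases3)
  from ruan_coneE[OF assms(2)[unfolded s]] obtain m X \<alpha> \<beta> where
    1: "N m X \<le> 1" "\<And>i j. i < n \<Longrightarrow> j < n \<Longrightarrow> v i j = sandwich m X \<alpha> \<beta> i j"
     "\<And>\<xi>. (\<Sum>p<m. (cmod (\<Sum>i<n. \<alpha> p i * cnj (\<xi> i)))\<^sup>2) \<le> quad_form n a \<xi>"
     "\<And>\<xi>. (\<Sum>p<m. (cmod (\<Sum>i<n. \<beta> p i * cnj (\<xi> i)))\<^sup>2) \<le> quad_form n b \<xi>" by blast
  \<comment> \<open>The square root goes to each outer factor, so the middle component and both
    dominated diagonals scale by \<open>c\<close>.\<close>
  let ?c = "complex_of_real (sqrt c)"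
  have cc: "(cmod ?c)\<^sup>2 = c" "?c * cnj ?c = of_real c"
    using assms(1) by (simp_all flip: of_real_mult)
  show ?thesis
    unfolding s rscale_def prod.case
  proof (rule ruan_coneI[where \<alpha> = "\<lambda>p. scaled ?c (\<alpha> p)" and \<beta> = "\<lambda>p. scaled ?c (\<beta> p)"])
    show "N m X \<le> 1" by fact
    show "sc (of_real c) (v i j) = sandwich m X (\<lambda>p. scaled ?c (\<alpha> p)) (\<lambda>p. scaled ?c (\<beta> p)) i j"
      if "i < n" "j < n" for i j
      unfolding sandwich_scaled cc(2) using 1(2)[OF that] by simp
  qed (use 1 assms(1) in \<open>auto simp only: norm_scaled_sum cc quad_form_scale intro!: mult_left_mono\<close>)
qed

definition ruan_unit where
  "ruan_unit n = (ident_mat n, 0 :: nat \<Rightarrow> nat \<Rightarrow> 'v, ident_mat n)"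

text \<open>Shows every n x n matrix as a product with trivial outer factors; used both for
  absorption and to recover the value of the functional at a given matrix.\<close>

lemma sandwich_std_basis:
  "sandwich n X std_basis std_basis = (\<lambda>i j. if i < n \<and> j < n then X i j else 0)"
proof (intro ext)
  fix i j
  have "sandwich n X std_basis std_basis i j = (\<Sum>p<n. \<Sum>q<n. if q = j then (if p = i then X p q else 0) else 0)"
    unfolding sandwich_def by (intro sum.cong) (auto simp: rank_one_def std_basis_def)
  then show "sandwich n X std_basis std_basis i j = (if i < n \<and> j < n then X i j else 0)"
    by (cases "j < n") auto
qed

lemma ruan_cone_absorb: "\<exists>t. rscale t (ruan_unit n) - s \<in> ruan_cone n"
proof -
  obtain a v b where s: "s = (a, v, b)" by (metis prod_cases3)
  \<comment> \<open>The added 1 keeps \<open>c\<close> positive when \<open>v\<close> vanishes, so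
    that \<open>v / c\<close> makes sense and has norm at most 1.\<close>
  define c where "c = N n v + 1"
  have c: "0 < c" using N_nonneg[of n v] by (simp add: c_def)
  define A where "A f = (\<Sum>i<n. \<Sum>j<n. cmod (f i j))" for f :: "nat \<Rightarrow> nat \<Rightarrow> complex"
  have A0: "0 \<le> A f" for f by (simp add: A_def sum_nonneg)
  \<comment> \<open>Large enough that \<open>t\<close> minus the entrywise constant of
    \<open>a\<close>, or of \<open>b\<close>, still exceeds \<open>c\<close>.\<close>
  define t where "t = c + A a + A b"
  let ?c = "complex_of_real (sqrt c)"
  let ?\<alpha> = "\<lambda>p. scaled ?c (std_basis p)"
  have cc: "(cmod ?c)\<^sup>2 = c" "?c * cnj ?c = of_real c"
    using c by (simp_all flip: of_real_mult)
  have nb: "(\<Sum>p<n. (cmod (\<Sum>i<n. std_basis p i * cnj (\<xi> i)))\<^sup>2) = (\<Sum>i<n. (cmod (\<xi> i))\<^sup>2)" for \<xi>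
  proof -
    have "(\<Sum>p<n. (cmod (\<Sum>i<n. std_basis p i * cnj (\<xi> i)))\<^sup>2) = quad_form n (ident_mat n) \<xi>"
      by (simp only: ident_mat_def quad_form_sum quad_form_rank_one)
    also have "\<dots> = (\<Sum>i<n. (cmod (\<xi> i))\<^sup>2)" by (rule quad_form_ident)
    finally show ?thesis .
  qed
  have q: "c * (\<Sum>i<n. (cmod (\<xi> i))\<^sup>2) \<le> quad_form n (\<lambda>i j. of_real t * ident_mat n i j - f i j) \<xi>"
    if "A f \<le> A a + A b" for f \<xi>
  proof -
    have "(\<lambda>i j. of_real t * ident_mat n i j - f i j) = (\<lambda>i j. of_real t * ident_mat n i j) + (\<lambda>i j. of_real (-1) * f i j)"
      by (auto simp: fun_eq_iff)
    then have "quad_form n (\<lambda>i j. of_real t * ident_mat n i j - f i j) \<xi> = t * (\<Sum>i<n. (cmod (\<xi> i))\<^sup>2) - quad_form n f \<xi>"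
      by (simp only: quad_form_add quad_form_scale quad_form_ident)
    also have "\<dots> \<ge> t * (\<Sum>i<n. (cmod (\<xi> i))\<^sup>2) - A f * (\<Sum>i<n. (cmod (\<xi> i))\<^sup>2)"
      unfolding A_def using quad_form_le[of n f \<xi>] by simp
    also have "t * (\<Sum>i<n. (cmod (\<xi> i))\<^sup>2) - A f * (\<Sum>i<n. (cmod (\<xi> i))\<^sup>2) = (t - A f) * (\<Sum>i<n. (cmod (\<xi> i))\<^sup>2)"
      by (simp add: algebra_simps)
    also have "\<dots> \<ge> c * (\<Sum>i<n. (cmod (\<xi> i))\<^sup>2)"
      using that by (intro mult_right_mono sum_nonneg) (auto simp: t_def)
    finally show ?thesis .
  qed
  have "(\<lambda>i j. of_real t * ident_mat n i j - a i j, \<lambda>i j. - v i j, \<lambda>i j. of_real t * ident_mat n i j - b i j) \<in> ruan_cone n"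
  proof (rule ruan_coneI[where \<alpha> = ?\<alpha> and \<beta> = ?\<alpha>])
    have "N n (\<lambda>i j. sc (of_real (-1/c)) (v i j)) = (1/c) * N n v"
      using c by (simp only: N_scale norm_of_real) simp
    then show "N n (\<lambda>i j. sc (of_real (-1/c)) (v i j)) \<le> 1" using c by (simp add: c_def)
    show "- v i j = sandwich n (\<lambda>i j. sc (of_real (-1/c)) (v i j)) ?\<alpha> ?\<alpha> i j" if "i < n" "j < n" for i j
      unfolding sandwich_scaled cc(2) sandwich_std_basis scale_scale of_real_mult[symmetric] using c that by simp
    show "(\<Sum>p<n. (cmod (\<Sum>i<n. ?\<alpha> p i * cnj (\<xi> i)))\<^sup>2) \<le> quad_form n (\<lambda>i j. of_real t * ident_mat n i j - a i j) \<xi>" for \<xi>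
      unfolding norm_scaled_sum cc(1) nb using A0 by (intro q) auto
    show "(\<Sum>p<n. (cmod (\<Sum>i<n. ?\<alpha> p i * cnj (\<xi> i)))\<^sup>2) \<le> quad_form n (\<lambda>i j. of_real t * ident_mat n i j - b i j) \<xi>" for \<xi>
      unfolding norm_scaled_sum cc(1) nb using A0 by (intro q) auto
  qed
  also have "(\<lambda>i j. of_real t * ident_mat n i j - a i j, \<lambda>i j. - v i j, \<lambda>i j. of_real t * ident_mat n i j - b i j) = rscale t (ruan_unit n) - s"
    by (auto simp: s rscale_def ruan_unit_def fun_eq_iff)
  finally show ?thesis ..
qed

text \<open>Membership writes \<open>- x\<close> as a product whose outer factors have norm at most
  \<open>sqrt t\<close> and whose middle factor has norm at most 1.\<close>

lemma ruan_cone_bound: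
  assumes n: "0 < n" and K: "rscale t (ruan_unit n) - (0, x, 0) \<in> ruan_cone n"
  shows "N n x \<le> t"
proof -
  have "rscale t (ruan_unit n) - (0, x, 0) = (\<lambda>i j. of_real t * ident_mat n i j, \<lambda>i j. - x i j, \<lambda>i j. of_real t * ident_mat n i j)"
    by (auto simp: rscale_def ruan_unit_def fun_eq_iff)
  from ruan_coneE[OF K[unfolded this]] obtain m X \<alpha> \<beta> where
    1: "N m X \<le> 1" "\<And>i j. i < n \<Longrightarrow> j < n \<Longrightarrow> - x i j = sandwich m X \<alpha> \<beta> i j"
     "\<And>\<xi>. (\<Sum>p<m. (cmod (\<Sum>i<n. \<alpha> p i * cnj (\<xi> i)))\<^sup>2) \<le> t * (\<Sum>i<n. (cmod (\<xi> i))\<^sup>2)"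
     "\<And>\<xi>. (\<Sum>p<m. (cmod (\<Sum>i<n. \<beta> p i * cnj (\<xi> i)))\<^sup>2) \<le> t * (\<Sum>i<n. (cmod (\<xi> i))\<^sup>2)"
    unfolding quad_form_scale quad_form_ident by blast
  \<comment> \<open>A nonzero test vector, available since \<open>0 < n\<close>, shows that
    \<open>t\<close> is nonnegative.\<close>
  have "(\<Sum>i<n. (cmod (std_basis 0 i))\<^sup>2) = (\<Sum>i<n. if i = 0 then 1 else 0)"
    by (intro sum.cong) (auto simp: std_basis_def)
  also have "\<dots> = (1::real)" using n by simp
  finally have "0 \<le> t" using order_trans[OF _ 1(3)[of "std_basis 0"]] by (simp add: sum_nonneg)
  have "N n x = N n (\<lambda>i j. sc (-1) (x i j))" using N_scale[of n "-1" x] by simp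
  also have "\<dots> = N n (sandwich m X \<alpha> \<beta>)" by (rule N_cong) (simp add: 1(2))
  also have "\<dots> \<le> t * N m X" by (rule N_sandwich[OF 1(3,4) \<open>0 \<le> t\<close>])
  also have "\<dots> \<le> t" using 1(1) \<open>0 \<le> t\<close> by (simp add: mult_left_le)
  finally show ?thesis .
qed

end

section \<open>Sesquilinear forms from the separating functional\<close>

text \<open>The standard complex-linear functional G(x) - i G(i x) with real part
  \<open>G\<close>.\<close>

definition complexified :: "(complex \<Rightarrow> 'w \<Rightarrow> 'w) \<Rightarrow> ((nat \<Rightarrow> nat \<Rightarrow> 'w) \<Rightarrow> real) \<Rightarrow> (nat \<Rightarrow> nat \<Rightarrow> 'w) \<Rightarrow> complex" where
  "complexified sc G x = Complex (G x) (- G (\<lambda>i j. sc \<i> (x i j)))"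

lemma complexified_linear:
  fixes sc :: "complex \<Rightarrow> 'w \<Rightarrow> 'w::ab_group_add"
  assumes vs: "vector_space sc" and add: "\<And>x y. G (x + y) = G x + G y"
    and scl: "\<And>c x. G (\<lambda>i j. sc (of_real c) (x i j)) = c * G x"
  shows "complexified sc G (x + y) = complexified sc G x + complexified sc G y"
    and "complexified sc G (\<lambda>i j. sc c (x i j)) = c * complexified sc G x"
    and "complexified sc G (\<lambda>i j. \<Sum>p\<in>S. z p i j) = (\<Sum>p\<in>S. complexified sc G (z p))"
proof -
  interpret vector_space sc by fact
  have F_add: "complexified sc G (x + y) = complexified sc G x + complexified sc G y" for x y
  proof -
    have "(\<lambda>i j. sc \<i> ((x + y) i j)) = (\<lambda>i j. sc \<i> (x i j)) + (\<lambda>i j. sc \<i> (y i j))"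
      by (simp add: fun_eq_iff scale_right_distrib)
    then show ?thesis by (simp add: complexified_def add complex_eq_iff)
  qed
  then show "complexified sc G (x + y) = complexified sc G x + complexified sc G y" .
  have 1: "(\<lambda>i j. sc c (x i j)) = (\<lambda>i j. sc (of_real (Re c)) (x i j)) + (\<lambda>i j. sc (of_real (Im c)) (sc \<i> (x i j)))"
    using complex_eq[of c] by (simp add: fun_eq_iff mult.commute flip: scale_left_distrib)
  have "\<i> * c = of_real (Re c) * \<i> + of_real (- Im c)" by (simp add: complex_eq_iff)
  then have 2: "(\<lambda>i j. sc \<i> (sc c (x i j))) = (\<lambda>i j. sc (of_real (Re c)) (sc \<i> (x i j))) + (\<lambda>i j. sc (of_real (- Im c)) (x i j))"
    unfolding scale_scale fun_eq_iff plus_fun_apply scale_left_distrib[symmetric] by simp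
  show "complexified sc G (\<lambda>i j. sc c (x i j)) = c * complexified sc G x"
    unfolding complexified_def 2 unfolding 1 add scl by (simp add: complex_eq_iff)
  have z: "complexified sc G (\<lambda>i j. 0) = 0"
    using F_add[of "\<lambda>i j. 0" "\<lambda>i j. 0"] by (simp add: func_plus)
  show "complexified sc G (\<lambda>i j. \<Sum>p\<in>S. z p i j) = (\<Sum>p\<in>S. complexified sc G (z p))"
  proof (induction S rule: infinite_finite_induct)
    case (insert p S)
    have "(\<lambda>i j. \<Sum>p\<in>insert p S. z p i j) = z p + (\<lambda>i j. \<Sum>p\<in>S. z p i j)"
      using insert by (auto simp: fun_eq_iff)
    then show ?case using insert by (simp add: F_add)
  qed (simp_all add: z)
qed

definition sesquilinear :: "((nat \<Rightarrow> complex) \<Rightarrow> (nat \<Rightarrow> complex) \<Rightarrow> complex) \<Rightarrow> bool" where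
  "sesquilinear H \<longleftrightarrow>
     (\<forall>f g h. H (f + g) h = H f h + H g h) \<and> (\<forall>c f h. H (scaled c f) h = c * H f h) \<and>
     (\<forall>f g h. H f (g + h) = H f g + H f h) \<and> (\<forall>c f h. H f (scaled c h) = cnj c * H f h)"

definition semi_inner :: "((nat \<Rightarrow> complex) \<Rightarrow> (nat \<Rightarrow> complex) \<Rightarrow> complex) \<Rightarrow> bool" where
  "semi_inner H \<longleftrightarrow> sesquilinear H \<and> (\<forall>f g. H g f = cnj (H f g)) \<and> (\<forall>f. 0 \<le> Re (H f f))"

lemma semi_innerD:
  assumes "semi_inner H"
  shows "sesquilinear H" and "H g f = cnj (H f g)" and "0 \<le> Re (H f f)"
proof -
  note * = assms[unfolded semi_inner_def]
  show "sesquilinear H" by (rule *[THEN conjunct1])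
  show "H g f = cnj (H f g)" by (rule *[THEN conjunct2, THEN conjunct1, rule_format])
  show "0 \<le> Re (H f f)" by (rule *[THEN conjunct2, THEN conjunct2, rule_format])
qed

lemma rank_one_sesquilinear:
  "rank_one (f + g) h = rank_one f h + rank_one g h"
  "rank_one (scaled c f) h = (\<lambda>i j. c * rank_one f h i j)"
  "rank_one f (g + h) = rank_one f g + rank_one f h"
  "rank_one f (scaled c h) = (\<lambda>i j. cnj c * rank_one f h i j)"
  by (simp_all add: rank_one_def scaled_def fun_eq_iff algebra_simps)

lemma vector_space_mult_complex: "vector_space ((*) :: complex \<Rightarrow> complex \<Rightarrow> complex)"
  by unfold_locales (simp_all add: algebra_simps)

text \<open>\<open>P\<close> is defined on all matrices, Hermitian or not. Positivity in both
  directions shows that it depends only on the quadratic form, so it does not distinguish a matrix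
  from its adjoint; this yields Hermitian symmetry.\<close>

lemma semi_inner_of_functional:
  fixes P :: "(nat \<Rightarrow> nat \<Rightarrow> complex) \<Rightarrow> real"
  assumes add: "\<And>x y. P (x + y) = P x + P y"
    and scl: "\<And>c x. P (\<lambda>i j. of_real c * x i j) = c * P x"
    and pos: "\<And>a. (\<And>\<xi>. 0 \<le> quad_form n a \<xi>) \<Longrightarrow> 0 \<le> P a"
  shows "semi_inner (\<lambda>\<alpha> \<beta>. complexified (*) P (rank_one \<alpha> \<beta>))"
proof -
  note cl = complexified_linear[where sc = "(*)" and G = P, OF vector_space_mult_complex add scl]
  have eq: "P a = P b" if "\<And>\<xi>. quad_form n a \<xi> = quad_form n b \<xi>" for a b
  proof -
    have le: "P b \<le> P a" if "\<And>\<xi>. quad_form n a \<xi> = quad_form n b \<xi>" for a b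
    proof -
      have "0 \<le> P (a + (\<lambda>i j. of_real (-1) * b i j))"
        by (rule pos) (simp only: quad_form_add quad_form_scale that)
      then show ?thesis unfolding add scl by simp
    qed
    show ?thesis by (intro antisym le) (simp_all add: that)
  qed
  have adj: "P (sos_adj M) = P M" for M by (rule eq) (rule quad_form_adj)
  have herm: "complexified (*) P (sos_adj M) = cnj (complexified (*) P M)" for M
  proof -
    have "(\<lambda>i j. \<i> * sos_adj M i j) = sos_adj (\<lambda>i j. of_real (-1) * (\<i> * M i j))"
      by (simp add: sos_adj_def fun_eq_iff)
    then have "P (\<lambda>i j. \<i> * sos_adj M i j) = - P (\<lambda>i j. \<i> * M i j)"
      by (simp only: adj scl)
    then show ?thesis by (simp add: complexified_def adj complex_eq_iff)
  qed
  have "complexified (*) P (rank_one g f) = cnj (complexified (*) P (rank_one f g))" for f g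
  proof -
    have "rank_one g f = sos_adj (rank_one f g)" by (simp add: rank_one_def sos_adj_def fun_eq_iff)
    then show ?thesis by (simp only: herm)
  qed
  moreover have "0 \<le> Re (complexified (*) P (rank_one f f))" for f
    by (simp add: complexified_def pos quad_form_rank_one)
  moreover have "sesquilinear (\<lambda>\<alpha> \<beta>. complexified (*) P (rank_one \<alpha> \<beta>))"
    unfolding sesquilinear_def by (simp add: rank_one_sesquilinear cl)
  ultimately show ?thesis unfolding semi_inner_def by (intro conjI allI)
qed

context operator_space
begin

text \<open>\<open>H0\<close> and \<open>H1\<close> evaluate the outer components of the separating
  functional on rank-one matrices, and \<open>B v\<close> evaluates the middle one on such a matrix
  tensored with \<open>v\<close>. The last identity is the normalisation at the order unit.\<close>

lemma ruan_forms:
  assumes n: "0 < n"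
  obtains H0 H1 B where "semi_inner H0" "semi_inner H1" "\<And>v. sesquilinear (B v)"
    "\<And>v w \<alpha> \<beta>. B (v + w) \<alpha> \<beta> = B v \<alpha> \<beta> + B w \<alpha> \<beta>" "\<And>c v \<alpha> \<beta>. B (sc c v) \<alpha> \<beta> = c * B v \<alpha> \<beta>"
    "\<And>m X \<alpha> \<beta>. cmod (\<Sum>p<m. \<Sum>q<m. B (X p q) (\<alpha> p) (\<beta> q))
       \<le> N m X * ((\<Sum>p<m. Re (H0 (\<alpha> p) (\<alpha> p))) + (\<Sum>q<m. Re (H1 (\<beta> q) (\<beta> q))))"
    "N n x \<le> cmod (\<Sum>i<n. \<Sum>j<n. B (x i j) (std_basis i) (std_basis j))"
    "(\<Sum>i<n. Re (H0 (std_basis i) (std_basis i))) + (\<Sum>i<n. Re (H1 (std_basis i) (std_basis i))) = 1"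
proof -
  \<comment> \<open>Expanding along the standard basis reproduces only the n x n corner, so
    \<open>x\<close> is truncated before separating.\<close>
  define x' where "x' = (\<lambda>i j. if i < n \<and> j < n then x i j else 0)"
  have Nx': "N n x' = N n x" by (rule N_cong) (simp add: x'_def)
  have bd: "N n x \<le> t" if "rscale t (ruan_unit n) - (0, x', 0) \<in> ruan_cone n" for t
    using ruan_cone_bound[OF n that] Nx' by simp
  obtain L where Ladd: "\<And>x y. L (x + y) = L x + L y" and Lscl: "\<And>c x. L (rscale c x) = c * L x"
    and Lpos: "\<And>s. s \<in> ruan_cone n \<Longrightarrow> 0 \<le> L s" and Lunit: "L (ruan_unit n) = 1" and Lx: "N n x \<le> L (0, x', 0)"
    by (rule cone_functional_exists[of rscale "ruan_cone n" "ruan_unit n" "(0, x', 0)" "N n x"],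
        rule vector_space_rscale, erule (1) ruan_cone_add, erule (1) ruan_cone_scale,
        rule ruan_cone_absorb, erule bd, rule that)
  define P0 where "P0 a = L (a, 0, 0)" for a
  define P1 where "P1 b = L (0, 0, b)" for b
  define G where "G v = L (0, v, 0)" for v
  have L_split: "L (a, v, b) = P0 a + G v + P1 b" for a v b
    unfolding P0_def P1_def G_def Ladd[symmetric] by simp
  have P0_add: "P0 (a + b) = P0 a + P0 b" and P1_add: "P1 (a + b) = P1 a + P1 b" for a b
    unfolding P0_def P1_def Ladd[symmetric] by simp_all
  have G_add: "G (v + w) = G v + G w" for v w unfolding G_def Ladd[symmetric] by simp
  have P0_scl: "P0 (\<lambda>i j. of_real c * a i j) = c * P0 a" and P1_scl: "P1 (\<lambda>i j. of_real c * a i j) = c * P1 a" for c a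
    unfolding P0_def P1_def Lscl[symmetric] by (simp_all add: rscale_def func_zero)
  have G_scl: "G (\<lambda>i j. sc (of_real c) (v i j)) = c * G v" for c v
    unfolding G_def Lscl[symmetric] by (simp add: rscale_def func_zero)
  \<comment> \<open>The empty product, \<open>m = 0\<close>, already contains all triples with zero
    middle part and positive diagonal.\<close>
  have pos0: "(a, 0, 0) \<in> ruan_cone n" "(0, 0, a) \<in> ruan_cone n" if "\<And>\<xi>. 0 \<le> quad_form n a \<xi>" for a
    by (rule ruan_coneI[where m = 0]; simp add: N_eq_0[THEN iffD2] sandwich_def that quad_form_zero)+
  have P0_pos: "0 \<le> P0 a" and P1_pos: "0 \<le> P1 a" if "\<And>\<xi>. 0 \<le> quad_form n a \<xi>" for a
    unfolding P0_def P1_def by (intro Lpos pos0 that)+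
  define H0 where "H0 \<alpha> \<beta> = complexified (*) P0 (rank_one \<alpha> \<beta>)" for \<alpha> \<beta>
  define H1 where "H1 \<alpha> \<beta> = complexified (*) P1 (rank_one \<alpha> \<beta>)" for \<alpha> \<beta>
  define F where "F = complexified sc G"
  define B where "B v \<alpha> \<beta> = F (\<lambda>i j. sc (rank_one \<alpha> \<beta> i j) v)" for v \<alpha> \<beta>
  have H0: "semi_inner H0" unfolding H0_def by (rule semi_inner_of_functional[OF P0_add P0_scl P0_pos])
  have H1: "semi_inner H1" unfolding H1_def by (rule semi_inner_of_functional[OF P1_add P1_scl P1_pos])
  note F = complexified_linear[where sc = sc and G = G, OF vector_space_axioms G_add G_scl, folded F_def]
  have B1: "B (v + w) \<alpha> \<beta> = B v \<alpha> \<beta> + B w \<alpha> \<beta>" for v w \<alpha> \<beta>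
    unfolding B_def F(1)[symmetric] by (simp add: scale_right_distrib func_plus)
  have B2: "B (sc c v) \<alpha> \<beta> = c * B v \<alpha> \<beta>" for c v \<alpha> \<beta>
    unfolding B_def F(2)[symmetric] by (simp add: mult.commute)
  have B3: "sesquilinear (B v)" for v
    unfolding sesquilinear_def B_def rank_one_sesquilinear F(1,2)[symmetric]
    by (simp add: scale_left_distrib func_plus)
  have B_sandwich: "(\<Sum>p<m. \<Sum>q<m. B (X p q) (\<alpha> p) (\<beta> q)) = F (sandwich m X \<alpha> \<beta>)" for m X \<alpha> \<beta>
    unfolding B_def sandwich_def F(3) ..
  have H0_sum: "P0 (\<lambda>i j. \<Sum>p<m. rank_one (\<alpha> p) (\<alpha> p) i j) = (\<Sum>p<m. Re (H0 (\<alpha> p) (\<alpha> p)))" for m \<alpha>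
    using arg_cong[OF complexified_linear(3)[OF vector_space_mult_complex P0_add P0_scl,
        where S = "{..<m}" and z = "\<lambda>p. rank_one (\<alpha> p) (\<alpha> p)"], of Re]
    by (simp add: H0_def complexified_def)
  have H1_sum: "P1 (\<lambda>i j. \<Sum>p<m. rank_one (\<alpha> p) (\<alpha> p) i j) = (\<Sum>p<m. Re (H1 (\<alpha> p) (\<alpha> p)))" for m \<alpha>
    using arg_cong[OF complexified_linear(3)[OF vector_space_mult_complex P1_add P1_scl,
        where S = "{..<m}" and z = "\<lambda>p. rank_one (\<alpha> p) (\<alpha> p)"], of Re]
    by (simp add: H1_def complexified_def)
  have B4: "cmod (\<Sum>p<m. \<Sum>q<m. B (X p q) (\<alpha> p) (\<beta> q))
       \<le> N m X * ((\<Sum>p<m. Re (H0 (\<alpha> p) (\<alpha> p))) + (\<Sum>q<m. Re (H1 (\<beta> q) (\<beta> q))))" for m X \<alpha> \<beta>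
  proof -
    define z where "z = F (sandwich m X \<alpha> \<beta>)"
    define r where "r = N m X"
    have "cmod z \<le> r * (P0 (\<lambda>i j. \<Sum>p<m. rank_one (\<alpha> p) (\<alpha> p) i j) + P1 (\<lambda>i j. \<Sum>p<m. rank_one (\<beta> p) (\<beta> p) i j))"
    \<comment> \<open>The degenerate cases allow no normalisation of \<open>X\<close> or no phase
      for \<open>z\<close>; in both \<open>z = 0\<close>, and the right-hand side is
      nonnegative.\<close>
    proof (cases "r = 0 \<or> z = 0")
      case True
      have "z = 0"
      proof (cases "r = 0")
        case True
        then have "X p q = 0" if "p < m" "q < m" for p q using that by (simp add: r_def N_eq_0)
        then have "sandwich m X \<alpha> \<beta> = (\<lambda>i j. sc 0 (sandwich m X \<alpha> \<beta> i j))"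
          by (simp add: sandwich_def)
        then have "z = F (\<lambda>i j. sc 0 (sandwich m X \<alpha> \<beta> i j))" unfolding z_def by (rule arg_cong)
        then show ?thesis by (simp only: F(2)) simp
      qed (use True in simp)
      moreover have "0 \<le> r" unfolding r_def by (rule N_nonneg)
      ultimately show ?thesis
        by (auto intro!: mult_nonneg_nonneg add_nonneg_nonneg P0_pos P1_pos sum_nonneg simp: quad_form_sum quad_form_rank_one)
    next
      case False
      then have r: "0 < r" and z0: "z \<noteq> 0" using N_nonneg[of m X] by (auto simp: r_def)
      \<comment> \<open>The phase that rotates \<open>z\<close> onto its modulus, so that the real
        functional \<open>G\<close> sees all of it.\<close>
      define \<theta> where "\<theta> = cnj z / of_real (cmod z)"
      have t1: "cmod \<theta> = 1" using z0 by (simp add: \<theta>_def norm_divide)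
      have "\<theta> * z = of_real (cmod z)"
        using z0 complex_norm_square[of z] by (simp add: \<theta>_def power2_eq_square field_simps)
      then have "F (\<lambda>i j. sc \<theta> (sandwich m X \<alpha> \<beta> i j)) = of_real (cmod z)"
        unfolding F(2) z_def .
      then have "G (\<lambda>i j. sc \<theta> (sandwich m X \<alpha> \<beta> i j)) = cmod z"
        by (metis F_def complexified_def complex.sel(1) Re_complex_of_real)
      then have Gz: "G (\<lambda>i j. sc (of_real (- 1 / r)) (sc \<theta> (sandwich m X \<alpha> \<beta> i j))) = - cmod z / r"
        by (simp only: G_scl) simp
      \<comment> \<open>The factor \<open>- 1 / r\<close> gives the middle matrix norm 1 and makes
        its contribution negative, so positivity of \<open>L\<close> reads as an upper bound on the
        modulus of \<open>z\<close>.\<close>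
      let ?X = "\<lambda>p q. sc (of_real (- 1 / r)) (sc \<theta> (X p q))"
      have "N m ?X = 1"
        by (simp only: N_scale t1 norm_of_real r_def[symmetric]) (use r in simp)
      then have "(\<lambda>i j. \<Sum>p<m. rank_one (\<alpha> p) (\<alpha> p) i j, \<lambda>i j. sc (of_real (- 1 / r)) (sc \<theta> (sandwich m X \<alpha> \<beta> i j)),
          \<lambda>i j. \<Sum>p<m. rank_one (\<beta> p) (\<beta> p) i j) \<in> ruan_cone n"
        by (intro ruan_coneI[where m = m and X = ?X and \<alpha> = \<alpha> and \<beta> = \<beta>])
          (simp_all add: quad_form_sum quad_form_rank_one sandwich_def scale_sum_right mult_ac)
      from Lpos[OF this] have "cmod z / r \<le> P0 (\<lambda>i j. \<Sum>p<m. rank_one (\<alpha> p) (\<alpha> p) i j) + P1 (\<lambda>i j. \<Sum>p<m. rank_one (\<beta> p) (\<beta> p) i j)"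
        unfolding L_split Gz by simp
      then show ?thesis using r by (simp add: field_simps)
    qed
    then show ?thesis unfolding H0_sum H1_sum B_sandwich z_def r_def .
  qed
  have "N n x \<le> Re (F x')" using Lx by (simp add: F_def complexified_def G_def)
  also have "\<dots> \<le> cmod (F x')" by (rule complex_Re_le_cmod)
  also have "F x' = (\<Sum>i<n. \<Sum>j<n. B (x i j) (std_basis i) (std_basis j))"
    unfolding B_sandwich sandwich_std_basis x'_def ..
  finally have B5: "N n x \<le> cmod (\<Sum>i<n. \<Sum>j<n. B (x i j) (std_basis i) (std_basis j))" .
  have "P0 (ident_mat n) + P1 (ident_mat n) = 1"
    using Lunit L_split[of "ident_mat n" 0 "ident_mat n"] G_scl[of 0 0] by (simp add: ruan_unit_def func_zero)
  then have B6: "(\<Sum>i<n. Re (H0 (std_basis i) (std_basis i))) + (\<Sum>i<n. Re (H1 (std_basis i) (std_basis i))) = 1"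
    unfolding ident_mat_def H0_sum H1_sum .
  show ?thesis by (rule that[OF H0 H1 B3 B1 B2 B4 B5 B6])
qed

end

section \<open>Gram-Schmidt for semi-inner products\<close>

lemma sesquilinear_sum:
  assumes "sesquilinear H"
  shows "H (\<Sum>k\<in>S. scaled (c k) (f k)) g = (\<Sum>k\<in>S. c k * H (f k) g)"
    and "H g (\<Sum>k\<in>S. scaled (c k) (f k)) = (\<Sum>k\<in>S. cnj (c k) * H g (f k))"
    and "H 0 g = 0" "H g 0 = 0" "H (f1 - f2) g = H f1 g - H f2 g" "H g (f1 - f2) = H g f1 - H g f2"
proof -
  have a: "H (f + g) h = H f h + H g h" "H f (g + h) = H f g + H f h"
    "H (scaled c f) h = c * H f h" "H f (scaled c h) = cnj c * H f h" for c f g h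
    using assms unfolding sesquilinear_def by blast+
  show z: "H 0 g = 0" "H g 0 = 0" for g using a(1)[of 0 0 g] a(2)[of g 0 0] by simp_all
  show "H (\<Sum>k\<in>S. scaled (c k) (f k)) g = (\<Sum>k\<in>S. c k * H (f k) g)"
    by (induction S rule: infinite_finite_induct) (simp_all only: sum.infinite sum.empty sum.insert a z not_False_eq_True)
  show "H g (\<Sum>k\<in>S. scaled (c k) (f k)) = (\<Sum>k\<in>S. cnj (c k) * H g (f k))"
    by (induction S rule: infinite_finite_induct) (simp_all only: sum.infinite sum.empty sum.insert a z not_False_eq_True)
  show "H (f1 - f2) g = H f1 g - H f2 g" using a(1)[of "f1 - f2" f2 g] by simp
  show "H g (f1 - f2) = H g f1 - H g f2" using a(2)[of g "f1 - f2" f2] by simp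
qed

text \<open>Zero vectors are admitted so that a degenerate form needs no basis of the quotient by its
  kernel.\<close>
definition orthosystem :: "((nat \<Rightarrow> complex) \<Rightarrow> (nat \<Rightarrow> complex) \<Rightarrow> complex) \<Rightarrow> nat \<Rightarrow> (nat \<Rightarrow> nat \<Rightarrow> complex) \<Rightarrow> bool" where
  "orthosystem H m e \<longleftrightarrow> (\<forall>k<m. e k = 0 \<or> H (e k) (e k) = 1) \<and> (\<forall>k<m. \<forall>l<m. k \<noteq> l \<longrightarrow> H (e k) (e l) = 0)"

lemma orthosystem_coeff:
  assumes H: "semi_inner H" and e: "orthosystem H m e" and l: "l < m"
  shows "H (\<Sum>k<m. scaled (c k) (e k)) (e l) = c l * H (e l) (e l)"
proof -
  note sq = semi_innerD(1)[OF H]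
  have "H (\<Sum>k<m. scaled (c k) (e k)) (e l) = (\<Sum>k<m. c k * H (e k) (e l))"
    by (rule sesquilinear_sum[OF sq])
  also have "\<dots> = (\<Sum>k<m. if k = l then c l * H (e l) (e l) else 0)"
    using e l by (intro sum.cong) (auto simp: orthosystem_def)
  finally show ?thesis using l by simp
qed

text \<open>Only an inequality, because the coefficient of a zero vector is lost.\<close>

lemma orthosystem_norm_le:
  assumes H: "semi_inner H" and e: "orthosystem H m e"
  shows "Re (H (\<Sum>k<m. scaled (c k) (e k)) (\<Sum>k<m. scaled (c k) (e k))) \<le> (\<Sum>k<m. (cmod (c k))\<^sup>2)"
proof -
  note sq = semi_innerD(1)[OF H]
  have "H (\<Sum>k<m. scaled (c k) (e k)) (\<Sum>k<m. scaled (c k) (e k)) = (\<Sum>k<m. cnj (c k) * (c k * H (e k) (e k)))"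
    unfolding sesquilinear_sum(2)[OF sq] using orthosystem_coeff[OF H e] by (intro sum.cong) auto
  also have "\<dots> = (\<Sum>k<m. of_real ((cmod (c k))\<^sup>2) * H (e k) (e k))"
    unfolding complex_norm_square by (simp add: mult_ac)
  finally have "Re (H (\<Sum>k<m. scaled (c k) (e k)) (\<Sum>k<m. scaled (c k) (e k))) = (\<Sum>k<m. (cmod (c k))\<^sup>2 * Re (H (e k) (e k)))"
    by (simp add: Re_sum)
  also have "\<dots> \<le> (\<Sum>k<m. (cmod (c k))\<^sup>2)"
  proof (rule sum_mono)
    fix k assume "k \<in> {..<m}"
    then have "e k = 0 \<or> H (e k) (e k) = 1" using e by (simp add: orthosystem_def)
    then show "(cmod (c k))\<^sup>2 * Re (H (e k) (e k)) \<le> (cmod (c k))\<^sup>2"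
      using sesquilinear_sum(3)[OF sq] by auto
  qed
  finally show ?thesis .
qed

text \<open>Orthogonality is trivial against a zero vector; otherwise
  \<open>H (e l) (e l) = 1\<close> cancels the coefficient. The second identity is Pythagoras, and
  with positivity it gives Bessel's inequality.\<close>

lemma orthosystem_residual:
  fixes f :: "nat \<Rightarrow> complex"
  assumes H: "semi_inner H" and e: "orthosystem H m e"
  defines "w \<equiv> f - (\<Sum>k<m. scaled (H f (e k)) (e k))"
  shows "l < m \<Longrightarrow> H w (e l) = 0" and "H w w = H f f - of_real (\<Sum>k<m. (cmod (H f (e k)))\<^sup>2)"
proof -
  note sq = semi_innerD(1)[OF H] and herm = semi_innerD(2)[OF H]
  show orth: "H w (e l) = 0" if "l < m" for l
  proof -
    have "H w (e l) = H f (e l) - H f (e l) * H (e l) (e l)"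
      unfolding w_def sesquilinear_sum(5)[OF sq] orthosystem_coeff[OF H e that] ..
    moreover have "e l = 0 \<or> H (e l) (e l) = 1" using e that by (simp add: orthosystem_def)
    ultimately show ?thesis using sesquilinear_sum(4)[OF sq] by auto
  qed
  have "H w (\<Sum>k<m. scaled (H f (e k)) (e k)) = 0"
    unfolding sesquilinear_sum(2)[OF sq] using orth by (intro sum.neutral) auto
  then have "H w w = H w f"
    using sesquilinear_sum(6)[OF sq, of w f "\<Sum>k<m. scaled (H f (e k)) (e k)"] by (simp add: w_def)
  also have "\<dots> = H f f - (\<Sum>k<m. H f (e k) * H (e k) f)"
    unfolding w_def sesquilinear_sum(5)[OF sq] sesquilinear_sum(1)[OF sq] ..
  also have "(\<Sum>k<m. H f (e k) * H (e k) f) = of_real (\<Sum>k<m. (cmod (H f (e k)))\<^sup>2)"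
  proof -
    have "H f (e k) * H (e k) f = of_real ((cmod (H f (e k)))\<^sup>2)" for k
      using herm[where f = f and g = "e k"] by (simp only: complex_norm_square)
    then show ?thesis by (simp only: of_real_sum)
  qed
  finally show "H w w = H f f - of_real (\<Sum>k<m. (cmod (H f (e k)))\<^sup>2)" .
qed

text \<open>Parseval for \<open>E i\<close> says that its residual is a null vector, the form that
  spanning takes for a degenerate semi-inner product.\<close>

lemma gram_schmidt_semi_inner:
  assumes H: "semi_inner H"
  shows "\<exists>e. orthosystem H m e \<and> (\<forall>i<m. Re (H (E i) (E i)) = (\<Sum>k<m. (cmod (H (E i) (e k)))\<^sup>2))"
proof (induction m)
  case 0
  then show ?case by (simp add: orthosystem_def)
next
  case (Suc m)
  note sq = semi_innerD(1)[OF H] and herm = semi_innerD(2)[OF H] and pos = semi_innerD(3)[OF H]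
  have scl: "H (scaled c f) g = c * H f g" "H g (scaled c f) = cnj c * H g f" for c f g
    using sq by (auto simp: sesquilinear_def)
  have real: "H f f = of_real (Re (H f f))" for f
    using arg_cong[OF herm[where f = f and g = f], of Im] by (simp add: complex_eq_iff)
  from Suc obtain e where e: "orthosystem H m e" and pars: "\<And>i. i < m \<Longrightarrow> Re (H (E i) (E i)) = (\<Sum>k<m. (cmod (H (E i) (e k)))\<^sup>2)"
    by blast
  define w where "w = E m - (\<Sum>k<m. scaled (H (E m) (e k)) (e k))"
  note res = orthosystem_residual[OF H e, where f = "E m", folded w_def]
  define s where "s = sqrt (Re (H w w))"
  \<comment> \<open>A null residual cannot be normalised and is replaced by 0; Parseval for
    \<open>E m\<close> then already holds with the old vectors.\<close>
  define u where "u = (if H w w = 0 then 0 else scaled (of_real (1 / s)) w)"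
  have s: "of_real s * of_real s = H w w"
  proof -
    have "s * s = Re (H w w)" using pos[where f = w] by (simp add: s_def)
    then show ?thesis using real[of w] by (simp only: of_real_mult[symmetric])
  qed
  have s0: "s \<noteq> 0" if "H w w \<noteq> 0" using s that by auto
  have uu: "u = 0 \<or> H u u = 1"
  proof (cases "H w w = 0")
    case False
    then have "H u u = of_real (1 / s) * (of_real (1 / s) * (of_real s * of_real s))"
      by (simp only: u_def scl s if_False complex_cnj_complex_of_real)
    then show ?thesis using s0[OF False] by simp
  qed (simp add: u_def)
  have ue: "H u (e l) = 0" if "l < m" for l
    using res(1)[OF that] sesquilinear_sum(3)[OF sq] by (simp add: u_def scl)
  then have eu: "H (e l) u = 0" if "l < m" for l using herm[where g = "e l" and f = u] ue[OF that] by simp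
  define e' where "e' = e(m := u)"
  have os: "orthosystem H (Suc m) e'"
    using e uu ue eu unfolding orthosystem_def by (auto simp: e'_def less_Suc_eq)
  have sum': "(\<Sum>k<Suc m. (cmod (H f (e' k)))\<^sup>2) = (\<Sum>k<m. (cmod (H f (e k)))\<^sup>2) + (cmod (H f u))\<^sup>2" for f
    by (simp add: e'_def)
  have "Re (H (E i) (E i)) = (\<Sum>k<Suc m. (cmod (H (E i) (e' k)))\<^sup>2)" if "i < Suc m" for i
  proof (cases "i = m")
    case True
    have "H (E m) u = H w u"
      unfolding w_def sesquilinear_sum(5)[OF sq] sesquilinear_sum(1)[OF sq] using eu by simp
    have "(cmod (H w u))\<^sup>2 = Re (H w w)"
    proof (cases "H w w = 0")
      case False
      then have "H w u = of_real (1 / s) * (of_real s * of_real s)"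
        by (simp only: u_def scl s if_False complex_cnj_complex_of_real)
      then have "H w u = of_real s" using s0[OF False] by simp
      then show ?thesis using pos[where f = w] by (simp add: s_def)
    qed (simp add: u_def sesquilinear_sum(4)[OF sq])
    also have "\<dots> = Re (H (E m) (E m)) - (\<Sum>k<m. (cmod (H (E m) (e k)))\<^sup>2)"
      by (simp only: res(2) minus_complex.sel Re_complex_of_real)
    finally show ?thesis unfolding sum' True \<open>H (E m) u = H w u\<close> by simp
  next
    case False
    then have "i < m" using that by simp
    \<comment> \<open>Bessel for the enlarged system against Parseval for the old one leaves no room
      for a new coefficient of \<open>E i\<close>.\<close>
    have "0 \<le> Re (H (E i) (E i)) - (\<Sum>k<Suc m. (cmod (H (E i) (e' k)))\<^sup>2)"
      using pos[where f = "E i - (\<Sum>k<Suc m. scaled (H (E i) (e' k)) (e' k))"]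
      by (simp only: orthosystem_residual(2)[OF H os] minus_complex.sel Re_complex_of_real)
    moreover have "0 \<le> (cmod (H (E i) u))\<^sup>2" by simp
    ultimately show ?thesis unfolding sum' using pars[OF \<open>i < m\<close>] by linarith
  qed
  with os show ?case by blast
qed

section \<open>Ruan's representation\<close>

lemma sesquilinear_double_sum:
  assumes "sesquilinear H"
  shows "H (\<Sum>k\<in>S. scaled (c k) (e k)) (\<Sum>l\<in>T. scaled (d l) (f l)) = (\<Sum>k\<in>S. \<Sum>l\<in>T. c k * cnj (d l) * H (e k) (f l))"
  by (simp only: sesquilinear_sum(1)[OF assms]) (simp only: sesquilinear_sum(2)[OF assms] sum_distrib_left mult.assoc)

text \<open>A finite set meets finitely many blocks and squared norms add over them, so a common
  bound for the blocks bounds the whole even when there are infinitely many.\<close>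

lemma form_bounded_block_diagonal:
  assumes off: "\<And>i j. i \<in> I \<Longrightarrow> j \<in> I \<Longrightarrow> c i \<noteq> c j \<Longrightarrow> A i j = 0"
    and diag: "\<And>t. form_bounded {i \<in> I. c i = t} A C"
  shows "form_bounded I A C"
proof (rule form_boundedI)
  fix F and \<eta> \<xi> :: "'a \<Rightarrow> complex" assume F: "finite F" "F \<subseteq> I"
  let ?F = "\<lambda>t. {i \<in> F. c i = t}"
  have grp: "(\<Sum>i\<in>F. h i) = (\<Sum>t\<in>c ` F. \<Sum>i\<in>?F t. h i)" for h :: "'a \<Rightarrow> 'c::comm_monoid_add"
    using F by (intro sum.group[symmetric]) auto
  have inner: "(\<Sum>j\<in>F. \<eta> i * A i j * \<xi> j) = (\<Sum>j\<in>?F t. \<eta> i * A i j * \<xi> j)" if "i \<in> ?F t" for i t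
  proof (rule sum.mono_neutral_right)
    show "\<forall>j\<in>F - ?F t. \<eta> i * A i j * \<xi> j = 0"
    proof
      fix j assume "j \<in> F - ?F t"
      then have "A i j = 0" using that F(2) by (intro off) auto
      then show "\<eta> i * A i j * \<xi> j = 0" by simp
    qed
  qed (use F in auto)
  have "(\<Sum>i\<in>F. \<Sum>j\<in>F. \<eta> i * A i j * \<xi> j) = (\<Sum>t\<in>c ` F. \<Sum>i\<in>?F t. \<Sum>j\<in>F. \<eta> i * A i j * \<xi> j)"
    by (rule grp)
  also have "\<dots> = (\<Sum>t\<in>c ` F. \<Sum>i\<in>?F t. \<Sum>j\<in>?F t. \<eta> i * A i j * \<xi> j)"
    by (intro sum.cong inner refl)
  finally have "2 * cmod (\<Sum>i\<in>F. \<Sum>j\<in>F. \<eta> i * A i j * \<xi> j) \<le> (\<Sum>t\<in>c ` F. 2 * cmod (\<Sum>i\<in>?F t. \<Sum>j\<in>?F t. \<eta> i * A i j * \<xi> j))"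
    by (simp only: sum_distrib_left[symmetric]) (intro mult_left_mono norm_sum, simp)
  also have "\<dots> \<le> (\<Sum>t\<in>c ` F. C * ((\<Sum>i\<in>?F t. (cmod (\<eta> i))\<^sup>2) + (\<Sum>i\<in>?F t. (cmod (\<xi> i))\<^sup>2)))"
    using F by (intro sum_mono form_bounded_rect[OF diag]) auto
  also have "\<dots> = C * ((\<Sum>i\<in>F. (cmod (\<eta> i))\<^sup>2) + (\<Sum>j\<in>F. (cmod (\<xi> j))\<^sup>2))"
    unfolding grp[of "\<lambda>i. (cmod (\<eta> i))\<^sup>2"] grp[of "\<lambda>i. (cmod (\<xi> i))\<^sup>2"]
    by (simp only: sum.distrib sum_distrib_left distrib_left)
  finally show "2 * cmod (\<Sum>i\<in>F. \<Sum>j\<in>F. \<eta> i * A i j * \<xi> j) \<le> C * ((\<Sum>i\<in>F. (cmod (\<eta> i))\<^sup>2) + (\<Sum>j\<in>F. (cmod (\<xi> j))\<^sup>2))" .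
qed

lemma block_form_eq:
  "(\<Sum>i\<in>{..<m} \<times> P. \<Sum>j\<in>{..<m} \<times> P. \<eta> i * sos_block m T i j * \<xi> j)
   = (\<Sum>p<m. \<Sum>q<m. \<Sum>k\<in>P. \<Sum>l\<in>P. \<eta> (p, k) * T p q k l * \<xi> (q, l))"
proof -
  have "(\<Sum>i\<in>{..<m} \<times> P. \<Sum>j\<in>{..<m} \<times> P. \<eta> i * sos_block m T i j * \<xi> j)
      = (\<Sum>p<m. \<Sum>k\<in>P. \<Sum>q<m. \<Sum>l\<in>P. \<eta> (p, k) * T p q k l * \<xi> (q, l))"
    by (simp add: sos_block_def sum.cartesian_product')
  also have "\<dots> = (\<Sum>p<m. \<Sum>q<m. \<Sum>k\<in>P. \<Sum>l\<in>P. \<eta> (p, k) * T p q k l * \<xi> (q, l))"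
    by (rule sum.cong[OF refl], rule sum.swap)
  finally show ?thesis .
qed

context operator_space
begin

text \<open>In the coordinates of the two orthosystems the semi-inner products are dominated by the
  standard norms, so the bound on \<open>B\<close> becomes complete contractivity. Nothing is lost
  at \<open>x\<close>, because basis vectors differ from their projections by null vectors.\<close>

lemma matrix_representation_exists:
  obtains \<phi> where "\<And>v w. \<phi> (v + w) = (\<lambda>k l. \<phi> v k l + \<phi> w k l)" "\<And>c v. \<phi> (sc c v) = (\<lambda>k l. c * \<phi> v k l)"
    "\<And>m X. form_bounded ({..<m} \<times> {..<n}) (sos_block m (\<lambda>p q. \<phi> (X p q))) (N m X)"
    "\<And>D. 0 \<le> D \<Longrightarrow> form_bounded ({..<n} \<times> {..<n}) (sos_block n (\<lambda>p q. \<phi> (x p q))) D \<Longrightarrow> N n x \<le> D"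
proof (cases "n = 0")
  case True
  have "N n x = 0" using True by (simp add: N_eq_0)
  then show ?thesis
    using True by (intro that[of "\<lambda>_ _ _. 0"]) (auto simp: form_bounded_def)
next
  case False
  then have "0 < n" by simp
  from ruan_forms[OF this, of x] obtain H0 H1 B where H0: "semi_inner H0" and H1: "semi_inner H1"
    and Bs: "\<And>v. sesquilinear (B v)"
    and B_add: "\<And>v w \<alpha> \<beta>. B (v + w) \<alpha> \<beta> = B v \<alpha> \<beta> + B w \<alpha> \<beta>"
    and B_scl: "\<And>c v \<alpha> \<beta>. B (sc c v) \<alpha> \<beta> = c * B v \<alpha> \<beta>"
    and bound: "\<And>m X \<alpha> \<beta>. cmod (\<Sum>p<m. \<Sum>q<m. B (X p q) (\<alpha> p) (\<beta> q))
       \<le> N m X * ((\<Sum>p<m. Re (H0 (\<alpha> p) (\<alpha> p))) + (\<Sum>q<m. Re (H1 (\<beta> q) (\<beta> q))))"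
    and low: "N n x \<le> cmod (\<Sum>i<n. \<Sum>j<n. B (x i j) (std_basis i) (std_basis j))"
    and unit: "(\<Sum>i<n. Re (H0 (std_basis i) (std_basis i))) + (\<Sum>i<n. Re (H1 (std_basis i) (std_basis i))) = 1"
    by blast
  obtain e where e: "orthosystem H0 n e"
    and e_pars: "\<And>i. i < n \<Longrightarrow> Re (H0 (std_basis i) (std_basis i)) = (\<Sum>k<n. (cmod (H0 (std_basis i) (e k)))\<^sup>2)"
    using gram_schmidt_semi_inner[OF H0, of n std_basis] by blast
  obtain f where f: "orthosystem H1 n f"
    and f_pars: "\<And>i. i < n \<Longrightarrow> Re (H1 (std_basis i) (std_basis i)) = (\<Sum>k<n. (cmod (H1 (std_basis i) (f k)))\<^sup>2)"
    using gram_schmidt_semi_inner[OF H1, of n std_basis] by blast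
  \<comment> \<open>The bound on \<open>B\<close> lacks the factor 2 of \<open>form_bounded\<close>;
    halving supplies it. In the lower bound the joint mass 1 of the two forms restores the
    constant.\<close>
  define \<phi> where "\<phi> v k l = B v (e k) (f l) / 2" for v k l
  have up: "form_bounded ({..<m} \<times> {..<n}) (sos_block m (\<lambda>p q. \<phi> (X p q))) (N m X)" for m X
  proof (rule form_bounded_cofinalI)
    fix F assume F: "finite F" "F \<subseteq> {..<m} \<times> {..<n}"
    let ?G = "{..<m} \<times> {..<n}"
    have "2 * cmod (\<Sum>i\<in>?G. \<Sum>j\<in>?G. \<eta> i * sos_block m (\<lambda>p q. \<phi> (X p q)) i j * \<xi> j)
        \<le> N m X * ((\<Sum>i\<in>?G. (cmod (\<eta> i))\<^sup>2) + (\<Sum>j\<in>?G. (cmod (\<xi> j))\<^sup>2))" for \<eta> \<xi>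
    proof -
      define \<alpha> where "\<alpha> p = (\<Sum>k<n. scaled (\<eta> (p, k)) (e k))" for p
      \<comment> \<open>\<open>B v\<close> is conjugate-linear in its second argument while the form
        bound is bilinear, hence the conjugate.\<close>
      define \<beta> where "\<beta> q = (\<Sum>l<n. scaled (cnj (\<xi> (q, l))) (f l))" for q
      have "B (X p q) (\<alpha> p) (\<beta> q) = 2 * (\<Sum>k<n. \<Sum>l<n. \<eta> (p, k) * \<phi> (X p q) k l * \<xi> (q, l))" for p q
        unfolding \<alpha>_def \<beta>_def sesquilinear_double_sum[OF Bs]
        by (simp add: \<phi>_def sum_distrib_left mult_ac)
      then have "(\<Sum>p<m. \<Sum>q<m. B (X p q) (\<alpha> p) (\<beta> q)) = 2 * (\<Sum>i\<in>?G. \<Sum>j\<in>?G. \<eta> i * sos_block m (\<lambda>p q. \<phi> (X p q)) i j * \<xi> j)"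
        by (simp only: block_form_eq sum_distrib_left[symmetric])
      then have "2 * cmod (\<Sum>i\<in>?G. \<Sum>j\<in>?G. \<eta> i * sos_block m (\<lambda>p q. \<phi> (X p q)) i j * \<xi> j)
          = cmod (\<Sum>p<m. \<Sum>q<m. B (X p q) (\<alpha> p) (\<beta> q))"
        by (simp only: norm_mult norm_numeral)
      also have "\<dots> \<le> N m X * ((\<Sum>p<m. Re (H0 (\<alpha> p) (\<alpha> p))) + (\<Sum>q<m. Re (H1 (\<beta> q) (\<beta> q))))"
        by (rule bound)
      also have "\<dots> \<le> N m X * ((\<Sum>p<m. \<Sum>k<n. (cmod (\<eta> (p, k)))\<^sup>2) + (\<Sum>q<m. \<Sum>l<n. (cmod (cnj (\<xi> (q, l))))\<^sup>2))"
        unfolding \<alpha>_def \<beta>_def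
        by (intro mult_left_mono N_nonneg add_mono sum_mono orthosystem_norm_le[OF H0 e] orthosystem_norm_le[OF H1 f])
      finally show ?thesis by (simp only: sum.cartesian_product' complex_mod_cnj)
    qed
    then show "\<exists>G. finite G \<and> F \<subseteq> G \<and> G \<subseteq> {..<m} \<times> {..<n} \<and> (\<forall>\<eta> \<xi>.
       2 * cmod (\<Sum>i\<in>G. \<Sum>j\<in>G. \<eta> i * sos_block m (\<lambda>p q. \<phi> (X p q)) i j * \<xi> j)
        \<le> N m X * ((\<Sum>i\<in>G. (cmod (\<eta> i))\<^sup>2) + (\<Sum>j\<in>G. (cmod (\<xi> j))\<^sup>2)))"
      using F by (intro exI[of _ ?G]) simp
  qed
  have bound1: "cmod (B v \<alpha> \<beta>) \<le> N 1 (\<lambda>_ _. v) * (Re (H0 \<alpha> \<alpha>) + Re (H1 \<beta> \<beta>))" for v \<alpha> \<beta>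
    using bound[where m = 1 and X = "\<lambda>_ _. v" and \<alpha> = "\<lambda>_. \<alpha>" and \<beta> = "\<lambda>_. \<beta>"] by simp
  have zero: "z = 0" if "\<And>t::real. 0 < t \<Longrightarrow> t * cmod z \<le> K" for z K
  proof (rule ccontr)
    assume "z \<noteq> 0"
    have "0 \<le> K" using that[of 1] norm_ge_zero[of z] by linarith
    then have "(K + 1) / cmod z * cmod z \<le> K" using \<open>z \<noteq> 0\<close> by (intro that divide_pos_pos) auto
    then show False using \<open>z \<noteq> 0\<close> by simp
  qed
  have scl: "H (scaled c f) g = c * H f g" "H g (scaled c f) = cnj c * H g f" if "sesquilinear H" for H c f g
    using that unfolding sesquilinear_def by blast+
  \<comment> \<open>Scaling a null vector by \<open>t\<close> multiplies the value of
    \<open>B\<close> by \<open>t\<close> but leaves the additive bound unchanged, which is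
    impossible for a nonzero value as \<open>t\<close> grows.\<close>
  have null0: "B v r \<beta> = 0" if r: "H0 r r = 0" for v r \<beta>
  proof (rule zero)
    fix t :: real assume "0 < t"
    then show "t * cmod (B v r \<beta>) \<le> N 1 (\<lambda>_ _. v) * Re (H1 \<beta> \<beta>)"
      using bound1[of v "scaled (of_real t) r" \<beta>] by (simp add: scl[OF Bs] scl[OF semi_innerD(1)[OF H0]] r norm_mult)
  qed
  have null1: "B v \<alpha> r = 0" if r: "H1 r r = 0" for v \<alpha> r
  proof (rule zero)
    fix t :: real assume "0 < t"
    then show "t * cmod (B v \<alpha> r) \<le> N 1 (\<lambda>_ _. v) * Re (H0 \<alpha> \<alpha>)"
      using bound1[of v \<alpha> "scaled (of_real t) r"] by (simp add: scl[OF Bs] scl[OF semi_innerD(1)[OF H1]] r norm_mult)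
  qed
  have real: "H g g = of_real (Re (H g g))" if "semi_inner H" for H g
    using arg_cong[OF semi_innerD(2)[OF that, where f = g and g = g], of Im] by (simp add: complex_eq_iff)
  \<comment> \<open>\<open>c\<close> and \<open>d\<close> are the coordinates of the standard basis
    in the two systems; by Parseval and \<open>unit\<close> their squared moduli over all index
    pairs sum to 1 altogether.\<close>
  define c where "c = (\<lambda>(i, k). H0 (std_basis i) (e k))"
  define d where "d = (\<lambda>(i, k). H1 (std_basis i) (f k))"
  have B_basis: "B v (std_basis i) (std_basis j) = 2 * (\<Sum>k<n. \<Sum>l<n. c (i, k) * \<phi> v k l * cnj (d (j, l)))"
    if ij: "i < n" "j < n" for v i j
  proof -
    let ?a = "\<Sum>k<n. scaled (c (i, k)) (e k)" and ?b = "\<Sum>l<n. scaled (d (j, l)) (f l)"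
    have "H0 (std_basis i - ?a) (std_basis i - ?a) = of_real (Re (H0 (std_basis i) (std_basis i))) - of_real (\<Sum>k<n. (cmod (c (i, k)))\<^sup>2)"
      using orthosystem_residual(2)[OF H0 e, where f = "std_basis i"] real[OF H0, of "std_basis i"] by (simp only: c_def prod.case)
    then have "H0 (std_basis i - ?a) (std_basis i - ?a) = 0"
      unfolding e_pars[OF ij(1)] by (simp add: c_def)
    from null0[OF this] have "B v (std_basis i) (std_basis j) = B v ?a (std_basis j)"
      unfolding sesquilinear_sum(5)[OF Bs] by simp
    have "H1 (std_basis j - ?b) (std_basis j - ?b) = of_real (Re (H1 (std_basis j) (std_basis j))) - of_real (\<Sum>k<n. (cmod (d (j, k)))\<^sup>2)"
      using orthosystem_residual(2)[OF H1 f, where f = "std_basis j"] real[OF H1, of "std_basis j"] by (simp only: d_def prod.case)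
    then have "H1 (std_basis j - ?b) (std_basis j - ?b) = 0"
      unfolding f_pars[OF ij(2)] by (simp add: d_def)
    from null1[OF this] have "B v ?a (std_basis j) = B v ?a ?b"
      unfolding sesquilinear_sum(6)[OF Bs] by simp
    also have "\<dots> = 2 * (\<Sum>k<n. \<Sum>l<n. c (i, k) * \<phi> v k l * cnj (d (j, l)))"
      unfolding sesquilinear_double_sum[OF Bs] by (simp add: \<phi>_def sum_distrib_left mult_ac)
    finally show ?thesis using \<open>B v (std_basis i) (std_basis j) = B v ?a (std_basis j)\<close> by simp
  qed
  have lo: "N n x \<le> D" if D: "0 \<le> D" "form_bounded ({..<n} \<times> {..<n}) (sos_block n (\<lambda>p q. \<phi> (x p q))) D" for D
  proof -
    let ?G = "{..<n} \<times> {..<n}"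
    have "(\<Sum>i<n. \<Sum>j<n. B (x i j) (std_basis i) (std_basis j))
        = (\<Sum>i<n. \<Sum>j<n. 2 * (\<Sum>k<n. \<Sum>l<n. c (i, k) * \<phi> (x i j) k l * cnj (d (j, l))))"
      by (intro sum.cong refl B_basis) auto
    also have "\<dots> = 2 * (\<Sum>i\<in>?G. \<Sum>j\<in>?G. c i * sos_block n (\<lambda>p q. \<phi> (x p q)) i j * cnj (d j))"
      by (simp only: block_form_eq sum_distrib_left[symmetric])
    finally have "N n x \<le> 2 * cmod (\<Sum>i\<in>?G. \<Sum>j\<in>?G. c i * sos_block n (\<lambda>p q. \<phi> (x p q)) i j * cnj (d j))"
      using low by (simp only: norm_mult norm_numeral)
    also have "\<dots> \<le> D * ((\<Sum>i\<in>?G. (cmod (c i))\<^sup>2) + (\<Sum>i\<in>?G. (cmod (cnj (d i)))\<^sup>2))"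
      by (rule form_bounded_rect[OF D(2)]) auto
    also have "(\<Sum>i\<in>?G. (cmod (c i))\<^sup>2) = (\<Sum>i<n. Re (H0 (std_basis i) (std_basis i)))"
      unfolding sum.cartesian_product' by (intro sum.cong refl) (simp add: e_pars c_def)
    also have "(\<Sum>i\<in>?G. (cmod (cnj (d i)))\<^sup>2) = (\<Sum>i<n. Re (H1 (std_basis i) (std_basis i)))"
      unfolding sum.cartesian_product' by (intro sum.cong refl) (simp add: f_pars d_def)
    finally show ?thesis unfolding unit by simp
  qed
  show ?thesis
    by (rule that[of \<phi>, OF _ _ up lo]) (auto simp: \<phi>_def B_add B_scl fun_eq_iff add_divide_distrib)
qed

text \<open>Every \<open>x\<close> labels its own n-dimensional summand. The summand labelled by
  \<open>X\<close> itself supplies the lower bound for \<open>X\<close>; all the others need only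
  the upper one.\<close>

theorem ruan_representation:
  obtains I :: "(nat \<times> (nat \<Rightarrow> nat \<Rightarrow> 'v) \<times> nat) set" and \<psi> where "ci_map sc N I \<psi>"
proof -
  define rep where "rep n x \<phi> \<longleftrightarrow>
    (\<forall>v w. \<phi> (v + w) = (\<lambda>k l. \<phi> v k l + \<phi> w k l)) \<and> (\<forall>c v. \<phi> (sc c v) = (\<lambda>k l. c * \<phi> v k l)) \<and>
    (\<forall>m X. form_bounded ({..<m} \<times> {..<n}) (sos_block m (\<lambda>p q. \<phi> (X p q))) (N m X)) \<and>
    (\<forall>D. 0 \<le> D \<longrightarrow> form_bounded ({..<n} \<times> {..<n}) (sos_block n (\<lambda>p q. \<phi> (x p q))) D \<longrightarrow> N n x \<le> D)" for n x \<phi>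
  have "\<exists>\<phi>. rep n x \<phi>" for n x
    by (rule matrix_representation_exists[of n x]) (unfold rep_def, blast)
  then obtain \<phi> where "\<And>n x. rep n x (\<phi> n x)" by metis
  note rep = this[unfolded rep_def]
  note add = rep[THEN conjunct1, rule_format]
    and scl = rep[THEN conjunct2, THEN conjunct1, rule_format]
    and up = rep[THEN conjunct2, THEN conjunct2, THEN conjunct1, rule_format]
    and lo = rep[THEN conjunct2, THEN conjunct2, THEN conjunct2, rule_format]
  define I :: "(nat \<times> (nat \<Rightarrow> nat \<Rightarrow> 'v) \<times> nat) set" where "I = {(n, x, k). k < n}"
  define \<psi> where "\<psi> v = (\<lambda>(n, x, k) (n', x', l). if n = n' \<and> x = x' \<and> k < n \<and> l < n then \<phi> n x v k l else 0)" for v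
  \<comment> \<open>Fixing the label \<open>(n, x)\<close> cuts out of
    \<open>{..<m} \<times> I\<close> exactly the block that carries
    \<open>\<phi> n x\<close>.\<close>
  have bij: "bij_betw (\<lambda>(p, k). (p, n, x, k)) ({..<m} \<times> {..<n}) {i \<in> {..<m} \<times> I. (\<lambda>(p, n, x, k). (n, x)) i = (n, x)}" for m n x
    by (auto simp: bij_betw_def inj_on_def I_def image_iff)
  have eq: "form_bounded ({..<m} \<times> {..<n}) (sos_block m (\<lambda>p q. \<phi> n x (X p q))) D \<longleftrightarrow>
      form_bounded {i \<in> {..<m} \<times> I. (\<lambda>(p, n, x, k). (n, x)) i = (n, x)} (sos_block m (\<lambda>p q. \<psi> (X p q))) D" for m n x X D
    by (rule form_bounded_reindex[OF bij]) (auto simp: sos_block_def \<psi>_def)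
  have "ci_map sc N I \<psi>"
  proof (rule ci_mapI)
    show "i \<notin> I \<or> j \<notin> I \<Longrightarrow> \<psi> v i j = 0" for v i j by (auto simp: \<psi>_def I_def split: prod.splits)
    show "\<psi> (v + w) = (\<lambda>i j. \<psi> v i j + \<psi> w i j)" for v w by (auto simp: \<psi>_def add fun_eq_iff)
    show "\<psi> (sc c v) = (\<lambda>i j. c * \<psi> v i j)" for c v by (auto simp: \<psi>_def scl fun_eq_iff)
    show "0 \<le> N n X" for n X by (rule N_nonneg)
    show "form_bounded ({..<m} \<times> I) (sos_block m (\<lambda>k l. \<psi> (X k l))) (N m X)" for m X
    proof (rule form_bounded_block_diagonal[where c = "\<lambda>(p, n, x, k). (n, x)"])
      show "form_bounded {i \<in> {..<m} \<times> I. (case i of (p, n, x, k) \<Rightarrow> (n, x)) = t} (sos_block m (\<lambda>k l. \<psi> (X k l))) (N m X)" for t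
        using up[of m "fst t" "snd t" X] eq[of m "fst t" "snd t" X] by simp
    qed (auto simp: sos_block_def \<psi>_def split: if_splits)
    show "N n X \<le> D" if "0 \<le> D" "form_bounded ({..<n} \<times> I) (sos_block n (\<lambda>k l. \<psi> (X k l))) D" for n X D
    proof (rule lo[OF that(1)])
      show "form_bounded ({..<n} \<times> {..<n}) (sos_block n (\<lambda>p q. \<phi> n X (X p q))) D"
        unfolding eq by (rule form_bounded_subset[OF that(2)]) auto
    qed
  qed
  then show ?thesis by (rule that)
qed

end

section \<open>The graded and the selfadjoint representation\<close>

theorem mainTheorem3:
  shows
  "(\<forall>(sc :: complex \<Rightarrow> 'x \<Rightarrow> 'x::ab_group_add) N st one.
      abstract_super_operator_system TYPE('i) sc N st one \<longrightarrow>
      (\<exists>(J :: ('i \<times> bool) set) E \<phi>.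
          E \<subseteq> J \<and> ci_map sc N J \<phi> \<and> \<phi> one = sos_id J \<and>
          (\<forall>x. \<phi> (st x) = sos_superadj E (\<phi> x))))
   \<and>
   (\<forall>(sc :: complex \<Rightarrow> 'v \<Rightarrow> 'v::ab_group_add) N st.
      abstract_super_operator_space sc N st \<longrightarrow>
      (\<exists>(H :: (nat \<times> (nat \<Rightarrow> nat \<Rightarrow> 'v) \<times> nat \<times> bool) set) \<nu>.
          ci_map sc N H \<nu> \<and> (\<forall>v. \<nu> (st v) = sos_adj (\<nu> v))))"
proof (intro conjI allI impI)
  fix sc :: "complex \<Rightarrow> 'x \<Rightarrow> 'x" and N st one
  assume "abstract_super_operator_system TYPE('i) sc N st one"
  then obtain I :: "'i set" and \<psi> where ci: "ci_map sc N I \<psi>" and one: "\<psi> one = sos_id I"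
    and st: "ca_involution sc N st" "st one = one"
    unfolding abstract_super_operator_system_def abstract_unital_operator_space_def by blast
  have inv: "st (st x) = x" for x using st(1) by (simp add: ca_involution_def)
  \<comment> \<open>Rows of the Hadamard rotation. With A = \<open>\<psi> x\<close> and B the
    adjoint of \<open>\<psi> (st x)\<close>, entries between equal signs become half of A + B, those
    between opposite signs half of A - B.\<close>
  define a :: "bool \<Rightarrow> real" where "a s = 1 / sqrt 2" for s
  define b :: "bool \<Rightarrow> real" where "b s = (if s then 1 else - 1) / sqrt 2" for s
  have ab: "orthogonal2 a b" by (simp add: orthogonal2_def a_def b_def power_divide)
  have aa: "a s * a t = 1 / 2" and bb: "b s * b t = (if s = t then 1 / 2 else - 1 / 2)" for s t
    by (simp_all add: a_def b_def)
  define J where "J = {j :: 'i \<times> bool. fst j \<in> I}"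
  define \<phi> where "\<phi> x j k = of_real (a (snd j) * a (snd k)) * \<psi> x (fst j) (fst k)
           + of_real (b (snd j) * b (snd k)) * sos_adj (\<psi> (st x)) (fst j) (fst k)" for x and j k :: "'i \<times> bool"
  have "bij (\<lambda>j :: 'i \<times> bool. (fst j, snd j))" using bij_id by (simp add: id_def)
  from ci_map_dilation[OF ci st(1) this ab ab] have "ci_map sc N J \<phi>" unfolding J_def \<phi>_def .
  \<comment> \<open>Since \<open>st one = one\<close>, both summands are the identity: they add up
    within one parity and cancel across parities.\<close>
  moreover have "\<phi> one = sos_id J"
    by (intro ext) (auto simp: \<phi>_def J_def one st(2) aa bb sos_id_def sos_adj_def)
  \<comment> \<open>Replacing \<open>x\<close> by \<open>st x\<close> exchanges the two summands up
    to adjoints, so only the difference changes sign; that sign is the product of the two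
    gradings.\<close>
  moreover have "\<phi> (st x) = sos_superadj {j \<in> J. snd j} (\<phi> x)" for x
  proof (intro ext)
    fix j k
    show "\<phi> (st x) j k = sos_superadj {j \<in> J. snd j} (\<phi> x) j k"
    proof (cases "j \<in> J \<and> k \<in> J")
      case True
      then show ?thesis
        by (auto simp: \<phi>_def inv sos_superadj_def sos_grade_def sos_adj_def aa bb)
    next
      case False
      then show ?thesis
        using ci_map_form_bounded(4)[OF ci]
        by (auto simp: \<phi>_def J_def sos_superadj_def sos_adj_def)
    qed
  qed
  ultimately show "\<exists>(J :: ('i \<times> bool) set) E \<phi>. E \<subseteq> J \<and> ci_map sc N J \<phi> \<and> \<phi> one = sos_id J \<and>
          (\<forall>x. \<phi> (st x) = sos_superadj E (\<phi> x))"
    by (intro exI[of _ J] exI[of _ "{j \<in> J. snd j}"] exI[of _ \<phi>]) auto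
next
  fix sc :: "complex \<Rightarrow> 'v \<Rightarrow> 'v" and N st
  assume "abstract_super_operator_space sc N st"
  then have "operator_space sc N" and st: "ca_involution sc N st"
    by (simp_all add: abstract_super_operator_space_def operator_space_def)
  then interpret operator_space sc N by simp
  obtain I :: "(nat \<times> (nat \<Rightarrow> nat \<Rightarrow> 'v) \<times> nat) set" and \<psi> where ci: "ci_map sc N I \<psi>"
    by (rule ruan_representation)
  have inv: "st (st x) = x" for x using st by (simp add: ca_involution_def)
  define pr where "pr = (\<lambda>(n :: nat, x :: nat \<Rightarrow> nat \<Rightarrow> 'v, k :: nat, s :: bool). (n, x, k))"
  define sg where "sg = (\<lambda>(n :: nat, x :: nat \<Rightarrow> nat \<Rightarrow> 'v, k :: nat, s :: bool). s)"
  \<comment> \<open>Unit vectors, taken as \<open>(a, b)\<close> for rows and \<open>(b, a)\<close>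
    for columns, put \<open>\<psi> x\<close> and the adjoint of \<open>\<psi> (st x)\<close> into
    opposite off-diagonal corners. Taking adjoints swaps the corners, as \<open>st\<close>
    requires.\<close>
  define a :: "bool \<Rightarrow> real" where "a s = (if s then 1 else 0)" for s
  define b :: "bool \<Rightarrow> real" where "b s = (if s then 0 else 1)" for s
  have ab: "orthogonal2 a b" and ba: "orthogonal2 b a" by (simp_all add: orthogonal2_def a_def b_def)
  have "bij (\<lambda>j. (pr j, sg j))"
    by (rule bijI') (auto simp: pr_def sg_def)
  define \<nu> where "\<nu> x j k = of_real (a (sg j) * b (sg k)) * \<psi> x (pr j) (pr k)
           + of_real (b (sg j) * a (sg k)) * sos_adj (\<psi> (st x)) (pr j) (pr k)" for x j k
  have "ci_map sc N {j. pr j \<in> I} \<nu>"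
    using ci_map_dilation[OF ci st \<open>bij (\<lambda>j. (pr j, sg j))\<close> ab ba] unfolding \<nu>_def .
  moreover have "\<nu> (st v) = sos_adj (\<nu> v)" for v
    by (intro ext) (simp add: \<nu>_def inv sos_adj_def mult.commute add.commute)
  ultimately show "\<exists>(H :: (nat \<times> (nat \<Rightarrow> nat \<Rightarrow> 'v) \<times> nat \<times> bool) set) \<nu>.
          ci_map sc N H \<nu> \<and> (\<forall>v. \<nu> (st v) = sos_adj (\<nu> v))"
    by blast
qed

end
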